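(* Let $\mathcal{F}=(S,\mathcal{I})$ be the combination of independence systems $(S_j,\mathcal{I}_j)$, $j\in[M]$, where each $(S_j,\mathcal{I}_j)$ is a $k_j$-growth system, let $w:S\to\mathbb{R}_{\ge0}$ be injective, and let $k=\max_{e\in S}\sum_{j:\,e\in S_j}k_j$. Then, for $p=\sqrt{1-1/(k+1)}$, the Free-Order General Secretary algorithm (described in the context) has utility-competitive ratio at least $$\frac12+\frac{1}{4k}-\frac12\sqrt{1+\frac1k}\ >\ \frac{1}{16k^2}-\frac{1}{32k^3}.$$ Furthermore, if all components are matroids (i.e. $\mathcal{F}$ is a $k$-matchoid, with all $k_j=1$), the algorithm has utility-competitive ratio at least $\frac14$ if $k=1$ (with $p=0$), and at least $\frac{1}{16k^2}$ if $k\ge2$ (with $p=1-\frac{1}{2k}$).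
   Context: An independence system $(S,\mathcal{I})$ is a finite set $S$ with a nonempty downward-closed family $\mathcal{I}\subseteq 2^S$ of independent sets; circuits are minimal non-independent sets; a basis of $X\subseteq S$ is a maximal independent subset of $X$. Write $X+e=X\cup\{e\}$ and $w(X)=\sum_{x\in X}w(x)$. An algorithm with random output $\mathrm{ALG}\in\mathcal{I}$ has utility-competitive ratio at least $\alpha$ if $\mathbb{E}[w(\mathrm{ALG})]\ge\alpha\,w(\mathrm{OPT})$, where $\mathrm{OPT}$ is a maximum-weight set in $\mathcal{I}$. Combination: the combination of $(S_j,\mathcal{I}_j)$, $j\in[M]$, is $(S,\mathcal{I})$ with $S=\bigcup_j S_j$ and $\mathcal{I}=\{I\subseteq S: I\cap S_j\in\mathcal{I}_j\ \forall j\}$. $k$-growth system ($k$ a positive integer): for all $X\subseteq S$ and all $I\in\mathcal{I}$ there is a partition $(Q,Z)$ of $I\setminus X$ with $|Z|\le k|X\setminus I|$ such that $P\cup Q\in\mathcal{I}$ for every basis $P$ of $X$. (The 1-growth systems are exactly matroids.) Primitive hull of component $j$: for $X\subseteq S_j$, $\mathrm{PHull}_j(X)=X\cup\{e\in S_j: e \text{ belongs to some circuit of }(S_j,\mathcal{I}_j)\text{ contained in }X+e\}$. Hull: $\mathrm{Hull}(X)=\bigcup_{j=1}^M\mathrm{PHull}_j(X\cap S_j)$ for $X\subseteq S$. $\mathrm{Greedy}(X)$: process the elements of $X$ in decreasing order of $w$, starting from $\emptyset$, adding an element whenever the current set stays in $\mathcal{I}$; $\mathrm{Greedy}(X)$ is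 the final set. $\mathrm{Rel}(Y)=\{y\in S\setminus Y: y\in\mathrm{Greedy}(Y+y)\}$. Free-Order General Secretary algorithm with parameter $p$ (the system is known, the weights are revealed only when an element is observed; the algorithm chooses the order of observation): 1. Set $\mathrm{ALG}=\emptyset$. For each $e\in S$ choose $t_e$ independently and uniformly from $(0,1)$. Let $Y=\{e: t_e\in(0,p)\}$, $S_1=\{e: t_e\in[p,(1+p)/2)\}$, $S_2=\{e: t_e\in[(1+p)/2,1)\}$. 2. Observe, without accepting, all elements of $Y\cup S_1$. Let $U=S_2$ (unseen elements). Sort the elements of $\mathrm{Rel}(Y)\cap S_1$ in decreasing order of weight as $e_1,\dots,e_m$. 3. For $j=1,\dots,m$: let $Q=U\cap\mathrm{Hull}(\{e_1,\dots,e_j\})$; for each $f\in Q$ in arbitrary order, remove $f$ from $U$ and reveal it; if $f\in\mathrm{Rel}(Y)$, $w(f)>w(e_j)$ and $\mathrm{ALG}+f\in\mathcal{I}$, add $f$ to $\mathrm{ALG}$. 4. For each remaining $f\in U$ in arbitrary order: if $f\in\mathrm{Rel}(Y)$ and $\mathrm{ALG}+f\in\mathcal{I}$, add $f$ to $\mathrm{ALG}$. 5. Return $\mathrm{ALG}$. *)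

theory Defs
  imports "HOL-Probability.Probability"
begin

section \<open>Independence systems\<close>

definition indep_system :: "'a set \<Rightarrow> 'a set set \<Rightarrow> bool" where
  "indep_system E I \<longleftrightarrow>
     finite E \<and> I \<subseteq> Pow E \<and> I \<noteq> {} \<and> (\<forall>A\<in>I. \<forall>B. B \<subseteq> A \<longrightarrow> B \<in> I)"

definition circuit :: "'a set \<Rightarrow> 'a set set \<Rightarrow> 'a set \<Rightarrow> bool" where
  "circuit E I C \<longleftrightarrow> C \<subseteq> E \<and> C \<notin> I \<and> (\<forall>D. D \<subset> C \<longrightarrow> D \<in> I)"

definition basis_of :: "'a set set \<Rightarrow> 'a set \<Rightarrow> 'a set \<Rightarrow> bool" where
  "basis_of I X P \<longleftrightarrow>
     P \<subseteq> X \<and> P \<in> I \<and> (\<forall>P'. P \<subseteq> P' \<and> P' \<subseteq> X \<and> P' \<in> I \<longrightarrow> P' = P)"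

definition growth_system :: "nat \<Rightarrow> 'a set \<Rightarrow> 'a set set \<Rightarrow> bool" where
  "growth_system k E I \<longleftrightarrow>
     0 < k \<and> indep_system E I \<and>
     (\<forall>X\<subseteq>E. \<forall>A\<in>I. \<exists>Q Z. Q \<union> Z = A - X \<and> Q \<inter> Z = {} \<and>
        card Z \<le> k * card (X - A) \<and> (\<forall>P. basis_of I X P \<longrightarrow> P \<union> Q \<in> I))"

definition matroid :: "'a set \<Rightarrow> 'a set set \<Rightarrow> bool" where
  "matroid E I \<longleftrightarrow>
     indep_system E I \<and>
     (\<forall>A\<in>I. \<forall>B\<in>I. card A < card B \<longrightarrow> (\<exists>x\<in>B - A. insert x A \<in> I))"

text \<open>
  The combination of the systems \<open>(Sj j, Ij j)\<close> for \<open>j \<in> {1..M}\<close>. The ground sets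
  \<open>Sj j\<close> may overlap; values of \<open>Sj\<close> and \<open>Ij\<close> outside \<open>{1..M}\<close> are irrelevant.
\<close>

definition comb_ground :: "nat \<Rightarrow> (nat \<Rightarrow> 'a set) \<Rightarrow> 'a set" where
  "comb_ground M Sj = (\<Union>j\<in>{1..M}. Sj j)"

definition comb_indep :: "nat \<Rightarrow> (nat \<Rightarrow> 'a set) \<Rightarrow> (nat \<Rightarrow> 'a set set) \<Rightarrow> 'a set set" where
  "comb_indep M Sj Ij = {A. A \<subseteq> comb_ground M Sj \<and> (\<forall>j\<in>{1..M}. A \<inter> Sj j \<in> Ij j)}"

definition phull :: "'a set \<Rightarrow> 'a set set \<Rightarrow> 'a set \<Rightarrow> 'a set" where
  "phull E I X = X \<union> {e \<in> E. \<exists>C. circuit E I C \<and> e \<in> C \<and> C \<subseteq> insert e X}"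

definition hull_comb ::
    "nat \<Rightarrow> (nat \<Rightarrow> 'a set) \<Rightarrow> (nat \<Rightarrow> 'a set set) \<Rightarrow> 'a set \<Rightarrow> 'a set" where
  "hull_comb M Sj Ij X = (\<Union>j\<in>{1..M}. phull (Sj j) (Ij j) (X \<inter> Sj j))"


section \<open>The greedy algorithm\<close>

text \<open>Only meaningful if \<open>X\<close> is finite and \<open>w\<close> is injective on \<open>X\<close>.\<close>

definition desc_list :: "('a \<Rightarrow> real) \<Rightarrow> 'a set \<Rightarrow> 'a list" where
  "desc_list w X = rev (sorted_key_list_of_set w X)"

text \<open>
  Process a list from left to right, adding to the current set each element that satisfies
  \<open>P\<close> and keeps the set in \<open>I\<close>.
\<close>

definition accept :: "'a set set \<Rightarrow> ('a \<Rightarrow> bool) \<Rightarrow> 'a list \<Rightarrow> 'a set \<Rightarrow> 'a set" where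
  "accept I P fs A = foldl (\<lambda>B f. if P f \<and> insert f B \<in> I then insert f B else B) A fs"

definition greedy :: "'a set set \<Rightarrow> ('a \<Rightarrow> real) \<Rightarrow> 'a set \<Rightarrow> 'a set" where
  "greedy I w X = accept I (\<lambda>_. True) (desc_list w X) {}"

definition rel :: "'a set \<Rightarrow> 'a set set \<Rightarrow> ('a \<Rightarrow> real) \<Rightarrow> 'a set \<Rightarrow> 'a set" where
  "rel E I w Y = {y \<in> E - Y. y \<in> greedy I w (insert y Y)}"


section \<open>The Free-Order General Secretary algorithm\<close>

text \<open>
  The steps ``for each \<open>f\<close> in arbitrary order'' are modelled by nondeterminism: the functions
  below return the set of all results that some choice of the orders can produce.
  In \<open>rounds H I w R D es (U, A)\<close>, \<open>H\<close> is the hull operator, \<open>R\<close> the set of relevant elements,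
  \<open>D\<close> the set of the \<open>e\<^sub>i\<close> of the earlier rounds, \<open>es\<close> the list of the \<open>e\<^sub>i\<close> still to be treated,
  \<open>U\<close> the set of unseen elements and \<open>A\<close> the current value of ALG.
\<close>

primrec rounds ::
    "('a set \<Rightarrow> 'a set) \<Rightarrow> 'a set set \<Rightarrow> ('a \<Rightarrow> real) \<Rightarrow> 'a set \<Rightarrow>
     'a set \<Rightarrow> 'a list \<Rightarrow> 'a set \<times> 'a set \<Rightarrow> ('a set \<times> 'a set) set" where
  "rounds H I w R D [] s = {s}"
| "rounds H I w R D (e # es) s =
     (\<Union>fs \<in> {fs. distinct fs \<and> set fs = fst s \<inter> H (insert e D)}.
        rounds H I w R (insert e D) es
          (fst s - set fs, accept I (\<lambda>f. f \<in> R \<and> w e < w f) fs (snd s)))"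

definition outcomes ::
    "('a set \<Rightarrow> 'a set) \<Rightarrow> 'a set \<Rightarrow> 'a set set \<Rightarrow> ('a \<Rightarrow> real) \<Rightarrow>
     'a set \<Rightarrow> 'a set \<Rightarrow> 'a set \<Rightarrow> 'a set set" where
  "outcomes H E I w Y S1 S2 =
     {accept I (\<lambda>f. f \<in> rel E I w Y) fs A | fs U A.
        (U, A) \<in> rounds H I w (rel E I w Y) {} (desc_list w (rel E I w Y \<inter> S1)) (S2, {}) \<and>
        distinct fs \<and> set fs = U}"

definition run_outcomes ::
    "nat \<Rightarrow> (nat \<Rightarrow> 'a set) \<Rightarrow> (nat \<Rightarrow> 'a set set) \<Rightarrow> ('a \<Rightarrow> real) \<Rightarrow> real \<Rightarrow>
     ('a \<Rightarrow> real) \<Rightarrow> 'a set set" where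
  "run_outcomes M Sj Ij w p \<tau> =
     outcomes (hull_comb M Sj Ij) (comb_ground M Sj) (comb_indep M Sj Ij) w
       {e \<in> comb_ground M Sj. \<tau> e \<in> {0<..<p}}
       {e \<in> comb_ground M Sj. \<tau> e \<in> {p..<(1 + p) / 2}}
       {e \<in> comb_ground M Sj. \<tau> e \<in> {(1 + p) / 2..<1}}"

text \<open>
  \<open>ALG\<close> is the random output of an execution with parameter \<open>p\<close> on the probability space
  \<open>\<Omega>\<close> with observation times \<open>t\<close>. The arbitrary orders may depend on \<open>\<omega>\<close> in any way for which
  the output is a random variable.
\<close>

definition free_order_execution ::
    "nat \<Rightarrow> (nat \<Rightarrow> 'a set) \<Rightarrow> (nat \<Rightarrow> 'a set set) \<Rightarrow> ('a \<Rightarrow> real) \<Rightarrow> real \<Rightarrow>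
     'b measure \<Rightarrow> ('a \<Rightarrow> 'b \<Rightarrow> real) \<Rightarrow> ('b \<Rightarrow> 'a set) \<Rightarrow> bool" where
  "free_order_execution M Sj Ij w p \<Omega> t ALG \<longleftrightarrow>
     prob_space \<Omega> \<and>
     prob_space.indep_vars \<Omega> (\<lambda>_. borel) t (comb_ground M Sj) \<and>
     (\<forall>e\<in>comb_ground M Sj. distr \<Omega> borel (t e) = uniform_measure lborel {0<..<1}) \<and>
     ALG \<in> measurable \<Omega> (count_space (Pow (comb_ground M Sj))) \<and>
     (\<forall>\<omega>\<in>space \<Omega>. ALG \<omega> \<in> run_outcomes M Sj Ij w p (\<lambda>e. t e \<omega>))"

definition utility_competitive ::
    "'a set set \<Rightarrow> ('a \<Rightarrow> real) \<Rightarrow> 'b measure \<Rightarrow> ('b \<Rightarrow> 'a set) \<Rightarrow> real \<Rightarrow> bool" where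
  "utility_competitive I w \<Omega> ALG \<alpha> \<longleftrightarrow>
     (\<forall>\<omega>\<in>space \<Omega>. ALG \<omega> \<in> I) \<and>
     (\<forall>OPT. is_arg_max (sum w) (\<lambda>A. A \<in> I) OPT \<longrightarrow>
        prob_space.expectation \<Omega> (\<lambda>\<omega>. sum w (ALG \<omega>)) \<ge> \<alpha> * sum w OPT)"

end

theory Submission
  imports Defs
begin

text \<open>
  Let \<open>R = Rel(Y)\<close>, and call \<open>f \<in> R\<close> \<^emph>\<open>unspanned\<close> if it is not in the hull of the heavier elements
  of \<open>R\<close>. Whether \<open>f\<close> is chosen by the greedy algorithm on \<open>Y + f\<close>, and whether it is spanned by the
  heavier elements of \<open>R\<close>, does not depend on \<open>f \<in> Y\<close>. So moving \<open>f\<close> into or out of \<open>Y\<close>, at a factor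
  of \<open>(1 - p) / p\<close>, compares \<open>R\<close> with \<open>Greedy(Y)\<close>, which is a \<open>k\<close>-approximation of the optimum
  within \<open>Y\<close>, and the spanned elements of \<open>R\<close> with the elements of \<open>Greedy(Y)\<close> spanned by \<open>R\<close>. The
  latter form an independent subset of the hull of \<open>R\<close>, and the growth property bounds them against
  \<open>R\<close>, at every weight threshold and hence in weight. This bounds the expected weight of the
  unspanned elements from below. For a single matroid and \<open>p = 0\<close>, all elements of the optimum are
  unspanned.

  An unspanned \<open>f\<close> is accepted with conditional probability at least \<open>1/4\<close>: if \<open>f \<in> S\<^sub>2\<close> and, going
  through the elements of \<open>R\<close> by decreasing weight, those in \<open>S\<^sub>1\<close> span \<open>f\<close> no later than those in
  \<open>S\<^sub>2 - f\<close>, then \<open>f\<close> is revealed before the accepted elements can block it, whatever the orders.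
\<close>

section \<open>Independence systems and hulls\<close>

lemma indep_system_subset: "indep_system E I \<Longrightarrow> A \<in> I \<Longrightarrow> B \<subseteq> A \<Longrightarrow> B \<in> I"
  unfolding indep_system_def by blast

lemma indep_system_empty: "indep_system E I \<Longrightarrow> {} \<in> I"
  unfolding indep_system_def by blast

lemma indep_system_ground: "indep_system E I \<Longrightarrow> A \<in> I \<Longrightarrow> A \<subseteq> E"
  unfolding indep_system_def by auto

lemma indep_system_finite: "indep_system E I \<Longrightarrow> finite E"
  unfolding indep_system_def by blast

lemma dependent_contains_circuit:
  assumes "indep_system E I" "X \<subseteq> E" "X \<notin> I"
  obtains C where "circuit E I C" "C \<subseteq> X"
proof -
  have "finite X"
    using assms indep_system_finite finite_subset by blast
  then have "X \<subseteq> E \<Longrightarrow> X \<notin> I \<Longrightarrow> \<exists>C. circuit E I C \<and> C \<subseteq> X"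
  proof (induction X rule: finite_psubset_induct)
    case (psubset X)
    show ?case
    proof (cases "\<forall>D. D \<subset> X \<longrightarrow> D \<in> I")
      case True
      then show ?thesis
        using psubset.prems unfolding circuit_def by blast
    next
      case False
      then show ?thesis
        using psubset.IH psubset.prems by (meson psubset_imp_subset subset_trans)
    qed
  qed
  then show ?thesis
    using assms that by blast
qed

text \<open>Since \<open>A\<close> contains no circuit, a circuit inside \<open>insert e A\<close>
  passes through \<open>e\<close>. Hence an independent set that blocks an element also spans
  it.\<close>

lemma mem_phullI:
  assumes sys: "indep_system E I" and "A \<in> I" "e \<in> E" "insert e A \<notin> I"
  shows "e \<in> phull E I A"
proof -
  have "insert e A \<subseteq> E"
    using assms indep_system_ground by blast
  then obtain C where C: "circuit E I C" "C \<subseteq> insert e A"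
    using dependent_contains_circuit[OF sys] assms by metis
  then have "e \<in> C"
    using indep_system_subset[OF sys \<open>A \<in> I\<close>, of C] unfolding circuit_def by blast
  then show ?thesis
    using C \<open>e \<in> E\<close> unfolding phull_def by blast
qed

lemma phull_mono: "X \<subseteq> Y \<Longrightarrow> phull E I X \<subseteq> phull E I Y"
  unfolding phull_def by blast

lemma extend_to_basis:
  assumes sys: "indep_system E I" and "A \<in> I" "A \<subseteq> X" "X \<subseteq> E"
  obtains P where "basis_of I X P" "A \<subseteq> P"
proof -
  have "finite X"
    using assms indep_system_finite finite_subset by blast
  then have "finite {P. A \<subseteq> P \<and> P \<subseteq> X \<and> P \<in> I}"
    using finite_subset[OF _ finite_Pow_iff[THEN iffD2]] by (metis (no_types, lifting) PowI mem_Collect_eq subsetI)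
  moreover have "A \<in> {P. A \<subseteq> P \<and> P \<subseteq> X \<and> P \<in> I}"
    using assms by blast
  ultimately obtain P where "P \<in> {P. A \<subseteq> P \<and> P \<subseteq> X \<and> P \<in> I}"
    "\<forall>Q\<in>{P. A \<subseteq> P \<and> P \<subseteq> X \<and> P \<in> I}. P \<subseteq> Q \<longrightarrow> P = Q"
    using finite_has_maximal2 by (metis (no_types, lifting))
  then show ?thesis
    using that[of P] unfolding basis_of_def by blast
qed

text \<open>A circuit through \<open>e\<close> becomes independent without \<open>e\<close> and then
  extends to a basis of \<open>X\<close>. This turns circuits into bases, the terms in which the
  growth property is stated.\<close>

lemma phull_obtain_basis:
  assumes sys: "indep_system E I" and "X \<subseteq> E" "e \<in> phull E I X" "e \<notin> X"
  obtains P where "basis_of I X P" "insert e P \<notin> I"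
proof -
  obtain C where C: "circuit E I C" "e \<in> C" "C \<subseteq> insert e X"
    using assms unfolding phull_def by blast
  have "C - {e} \<subset> C" "C - {e} \<subseteq> X"
    using C by blast+
  then have "C - {e} \<in> I"
    using C(1) unfolding circuit_def by blast
  then obtain P where P: "basis_of I X P" "C - {e} \<subseteq> P"
    using extend_to_basis[OF sys _ \<open>C - {e} \<subseteq> X\<close> \<open>X \<subseteq> E\<close>] by metis
  have "C \<subseteq> insert e P"
    using P(2) by blast
  then have "insert e P \<notin> I"
    using indep_system_subset[OF sys] C(1) unfolding circuit_def by metis
  with P(1) show ?thesis
    by (rule that)
qed

section \<open>Cardinality bounds from the growth property\<close>

lemma growth_system_indep: "growth_system k E I \<Longrightarrow> indep_system E I"
  unfolding growth_system_def by blast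

text \<open>The elements of \<open>D\<close> must all lie in the part \<open>Z\<close> of the partition of \<open>A - X\<close>.\<close>

lemma growth_system_card_le:
  assumes gs: "growth_system k E I" and "X \<subseteq> E" "A \<in> I" "D \<subseteq> A - X"
    and dep: "\<And>a. a \<in> D \<Longrightarrow> \<exists>P. basis_of I X P \<and> insert a P \<notin> I"
  shows "card D \<le> k * card (X - A)"
proof -
  obtain Q Z where QZ: "Q \<union> Z = A - X" "Q \<inter> Z = {}" "card Z \<le> k * card (X - A)"
      "\<And>P. basis_of I X P \<Longrightarrow> P \<union> Q \<in> I"
    using gs assms(2,3) unfolding growth_system_def by meson
  have sys: "indep_system E I"
    by (rule growth_system_indep[OF gs])
  have "D \<subseteq> Z"
  proof
    fix a assume "a \<in> D"
    then obtain P where P: "basis_of I X P" "insert a P \<notin> I"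
      using dep by blast
    then have "a \<notin> Q"
      using QZ(4)[OF P(1)] indep_system_subset[OF sys, of "P \<union> Q" "insert a P"] by blast
    then show "a \<in> Z"
      using \<open>a \<in> D\<close> QZ \<open>D \<subseteq> A - X\<close> by blast
  qed
  moreover have "finite Z"
    using QZ indep_system_ground[OF sys \<open>A \<in> I\<close>] indep_system_finite[OF sys]
    by (metis Un_upper2 finite_Diff finite_subset)
  ultimately show ?thesis
    using QZ(3) card_mono le_trans by blast
qed

text \<open>Different elements of \<open>F\<close> may be blocked by different bases of
  \<open>X\<close>. The growth property covers this because its part \<open>Q\<close> fits every
  basis at once, so no element of \<open>F\<close> can lie in \<open>Q\<close>.\<close>

lemma growth_system_card_phull:
  assumes gs: "growth_system k E I" and "X \<subseteq> E" "F \<in> I" "F \<inter> X = {}" "F \<subseteq> phull E I X"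
  shows "card F \<le> k * card X"
proof -
  have "\<exists>P. basis_of I X P \<and> insert a P \<notin> I" if "a \<in> F" for a
  proof -
    have "a \<in> phull E I X" "a \<notin> X"
      using that assms by blast+
    then show ?thesis
      using phull_obtain_basis[OF growth_system_indep[OF gs] \<open>X \<subseteq> E\<close>] by metis
  qed
  then have "card F \<le> k * card (X - F)"
    using growth_system_card_le[OF gs, of X F F] assms by blast
  also have "X - F = X"
    using assms by blast
  finally show ?thesis .
qed

text \<open>The case \<open>X = G\<close>: an independent set is a basis of itself, so
  \<open>G\<close> is the basis that blocks every element of \<open>D\<close>.\<close>

lemma growth_system_card_dependent:
  assumes gs: "growth_system k E I" and "G \<in> I" "A \<in> I" "D \<subseteq> A - G"
    and dep: "\<And>a. a \<in> D \<Longrightarrow> insert a G \<notin> I"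
  shows "card D \<le> k * card (G - A)"
proof -
  have "basis_of I G G"
    using \<open>G \<in> I\<close> unfolding basis_of_def by blast
  then have "\<exists>P. basis_of I G P \<and> insert a P \<notin> I" if "a \<in> D" for a
    using dep[OF that] by blast
  then show ?thesis
    by (intro growth_system_card_le[OF gs] assms
        indep_system_ground[OF growth_system_indep[OF gs] \<open>G \<in> I\<close>])
qed

section \<open>Bases and hulls in matroids\<close>

lemma basis_of_subset: "basis_of I X P \<Longrightarrow> P \<subseteq> X"
  unfolding basis_of_def by blast

lemma basis_of_indep: "basis_of I X P \<Longrightarrow> P \<in> I"
  unfolding basis_of_def by blast

lemma basis_of_maximal:
  assumes "basis_of I X P" "x \<in> X" "x \<notin> P"
  shows "insert x P \<notin> I"
proof -
  have "P \<subseteq> insert x P \<and> insert x P \<subseteq> X"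
    using assms basis_of_subset by blast
  then show ?thesis
    using assms unfolding basis_of_def by blast
qed

lemma matroid_indep_system: "matroid E I \<Longrightarrow> indep_system E I"
  unfolding matroid_def by blast

lemma matroid_augment:
  "matroid E I \<Longrightarrow> A \<in> I \<Longrightarrow> B \<in> I \<Longrightarrow> card A < card B \<Longrightarrow> \<exists>x\<in>B - A. insert x A \<in> I"
  unfolding matroid_def by blast

text \<open>In a matroid the choice of the basis does not matter: \<open>P\<close> is no larger than
  \<open>B\<close>, so an independent \<open>insert f B\<close> would augment \<open>P\<close>,
  either by \<open>f\<close> or by an element of \<open>X\<close>, and both are excluded.\<close>

lemma matroid_basis_insert_dependent:
  assumes mat: "matroid E I" and "X \<subseteq> E" and P: "basis_of I X P" and B: "basis_of I X B"
    and f: "f \<notin> X" "insert f P \<notin> I"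
  shows "insert f B \<notin> I"
proof
  assume fB: "insert f B \<in> I"
  have "finite B"
    using \<open>X \<subseteq> E\<close> basis_of_subset[OF B] indep_system_finite[OF matroid_indep_system[OF mat]]
    by (meson finite_subset)
  have "card P \<le> card B"
  proof (rule ccontr)
    assume "\<not> card P \<le> card B"
    then have "card B < card P"
      by simp
    from matroid_augment[OF mat basis_of_indep[OF B] basis_of_indep[OF P] this]
    obtain x where "x \<in> P - B" "insert x B \<in> I"
      by blast
    then show False
      using basis_of_subset[OF P] basis_of_maximal[OF B, of x] by blast
  qed
  moreover have "f \<notin> B"
    using f basis_of_subset[OF B] by blast
  ultimately have "card P < card (insert f B)"
    using \<open>finite B\<close> by simp
  from matroid_augment[OF mat basis_of_indep[OF P] fB this]
  obtain x where x: "x \<in> insert f B - P" "insert x P \<in> I"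
    by blast
  then have "x \<in> X"
    using f basis_of_subset[OF B] by blast
  then show False
    using x basis_of_maximal[OF P, of x] by blast
qed

text \<open>The elements of \<open>R\<close> not spanned by heavier ones form the set
  \<open>B\<close> that greedy selection from \<open>R\<close> would produce. So
  \<open>card B\<close> is the rank of \<open>R\<close>, which bounds the independent set
  \<open>F\<close> in the hull of \<open>R\<close>, and the rest of \<open>R\<close> is exactly its
  spanned part.\<close>

lemma matroid_card_phull:
  fixes w :: "'a \<Rightarrow> real"
  assumes mat: "matroid E I" and inj: "inj_on w E" and R: "R \<subseteq> E"
    and F: "F \<in> I" "F \<inter> R = {}"
    and F_hull: "\<And>f. f \<in> F \<Longrightarrow> f \<in> phull E I {e \<in> R. w f < w e}"
  shows "card F + card {f \<in> R. f \<in> phull E I {e \<in> R. w f < w e}} \<le> card R"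
proof -
  define up where "up f = {e \<in> R. w f < w e}" for f
  define B where "B = {f \<in> R. f \<notin> phull E I (up f)}"
  have sys: "indep_system E I"
    using mat unfolding matroid_def by blast
  have finE: "finite E" and "finite R"
    using sys R indep_system_finite finite_subset by blast+
  have "F \<subseteq> E"
    using F indep_system_ground[OF sys] by blast
  have "finite F"
    using \<open>F \<subseteq> E\<close> finE finite_subset by blast
  have "B \<in> I"
  proof (rule ccontr)
    assume "B \<notin> I"
    moreover have "B \<subseteq> E" using R B_def by blast
    ultimately obtain C where C: "circuit E I C" "C \<subseteq> B"
      using dependent_contains_circuit[OF sys] by metis
    then have "C \<noteq> {}" "finite C"
      using indep_system_empty[OF sys] finE finite_subset[OF _ finE] unfolding circuit_def by auto
    \<comment> \<open>The lightest element of a circuit is spanned by the other ones, which are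
      strictly heavier by injectivity.\<close>
    then obtain f where f: "f \<in> C" "\<And>e. e \<in> C \<Longrightarrow> w f \<le> w e"
      by (metis arg_min_if_finite(1) arg_min_least)
    have "C \<subseteq> insert f (up f)"
    proof
      fix e assume "e \<in> C"
      moreover have "e \<in> R" "e \<in> E" "f \<in> E"
        using \<open>e \<in> C\<close> f C R unfolding B_def by blast+
      ultimately show "e \<in> insert f (up f)"
        using f(2)[of e] inj_onD[OF inj, of e f] unfolding up_def by force
    qed
    then have "f \<in> phull E I (up f)"
      using C f unfolding phull_def circuit_def by blast
    then show False
      using f C B_def by blast
  qed
  have "card F \<le> card B"
  proof (rule ccontr)
    assume "\<not> card F \<le> card B"
    then have "card B < card F"
      by simp
    from matroid_augment[OF mat \<open>B \<in> I\<close> F(1) this]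
    obtain x0 where x0: "x0 \<in> F - B" "insert x0 B \<in> I"
      by blast
    \<comment> \<open>These elements are not blocked by the heavier part of \<open>B\<close>. For
      the heaviest of them, \<open>x\<close>, no heavier element of \<open>R\<close> outside
      \<open>B\<close> extends the heavier part of \<open>B\<close>, which is therefore a basis of
      \<open>up x\<close>. But \<open>x\<close> is in the hull of \<open>up x\<close>, so that basis
      must block \<open>x\<close>.\<close>
    define K where "K = {x \<in> (R \<union> F) - B. insert x {e \<in> B. w x < w e} \<in> I}"
    have "x0 \<in> K"
      using x0(1) indep_system_subset[OF sys x0(2), of "insert x0 {e \<in> B. w x0 < w e}"]
      unfolding K_def by blast
    moreover have "finite K"
      using \<open>finite R\<close> \<open>finite F\<close> unfolding K_def by simp
    ultimately obtain x where x: "x \<in> K" "\<And>y. y \<in> K \<Longrightarrow> w y \<le> w x"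
      using Max_in[of "w ` K"] Max_ge[of "w ` K"] by (metis (no_types, lifting) empty_iff finite_imageI image_iff)
    have x_hull: "x \<in> phull E I (up x)"
      using x(1) F_hull[of x] unfolding K_def B_def up_def by blast
    have xup: "x \<notin> up x" "up x \<subseteq> E"
      using R unfolding up_def by auto
    have basis: "basis_of I (up x) {e \<in> B. w x < w e}"
      unfolding basis_of_def
    proof (intro conjI allI impI)
      show "{e \<in> B. w x < w e} \<subseteq> up x"
        unfolding B_def up_def by blast
      show "{e \<in> B. w x < w e} \<in> I"
        by (rule indep_system_subset[OF sys \<open>B \<in> I\<close>]) blast
      fix P assume P: "{e \<in> B. w x < w e} \<subseteq> P \<and> P \<subseteq> up x \<and> P \<in> I"
      have "y \<in> B" if "y \<in> P" for y
      proof (rule ccontr)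
        assume "y \<notin> B"
        have y: "y \<in> R" "w x < w y"
          using that P unfolding up_def by blast+
        then have "insert y {e \<in> B. w y < w e} \<subseteq> P"
          using P that by auto
        then have "insert y {e \<in> B. w y < w e} \<in> I"
          using indep_system_subset[OF sys] P by metis
        then have "y \<in> K"
          using y \<open>y \<notin> B\<close> unfolding K_def by blast
        then show False
          using x(2) y by force
      qed
      then show "P = {e \<in> B. w x < w e}"
        using P unfolding up_def by blast
    qed
    obtain P where "basis_of I (up x) P" "insert x P \<notin> I"
      using phull_obtain_basis[OF sys xup(2) x_hull xup(1)] by metis
    then have "insert x {e \<in> B. w x < w e} \<notin> I"
      using matroid_basis_insert_dependent[OF mat xup(2) _ basis xup(1)] by metis
    then show False
      using x(1) unfolding K_def by blast
  qed
  moreover have "R = B \<union> {f \<in> R. f \<in> phull E I (up f)}" "B \<inter> {f \<in> R. f \<in> phull E I (up f)} = {}"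
    unfolding B_def by blast+
  then have "card R = card B + card {f \<in> R. f \<in> phull E I (up f)}"
    using \<open>finite R\<close> by (metis card_Un_disjoint finite_Un)
  ultimately show ?thesis
    unfolding up_def by linarith
qed

section \<open>Sums over weight thresholds\<close>

text \<open>Abel summation: a weighted sum is a nonnegative combination of the sums over the sets
  \<open>{s \<in> S. w s > \<theta>}\<close>.\<close>

lemma weighted_sum_nonneg:
  fixes w x :: "'a \<Rightarrow> real"
  assumes "finite S" "inj_on w S" "\<And>s. s \<in> S \<Longrightarrow> 0 \<le> w s"
    and prefix: "\<And>\<theta>. 0 \<le> (\<Sum>s | s \<in> S \<and> \<theta> < w s. x s)"
  shows "0 \<le> (\<Sum>s\<in>S. w s * x s)"
proof -
  \<comment> \<open>The claim is strengthened by a lower bound \<open>m\<close> on the weights,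
    because the induction splits off the lightest element \<open>a\<close> and then uses the
    hypothesis with \<open>m = w a\<close>.\<close>
  have "m * sum x S \<le> (\<Sum>s\<in>S. w s * x s)"
    if "0 \<le> m" "\<And>s. s \<in> S \<Longrightarrow> m \<le> w s" "inj_on w S"
      "\<And>\<theta>. 0 \<le> (\<Sum>s | s \<in> S \<and> \<theta> < w s. x s)" for m
    using \<open>finite S\<close> that
  proof (induction S arbitrary: m rule: finite_ranking_induct[where f = "\<lambda>s. - w s"])
    case empty
    then show ?case by simp
  next
    case (insert a S)
    show ?case
    proof (cases "a \<in> S")
      case True
      then show ?thesis
        using insert.IH[of m] insert.prems by (simp add: insert_absorb)
    next
      case False
      have less: "w a < w s" if "s \<in> S" for s
        using insert.hyps(2)[OF that] insert.prems(3) that False unfolding inj_on_def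
        by (metis insertCI le_less neg_le_iff_le)
      have pre: "0 \<le> (\<Sum>s | s \<in> S \<and> \<theta> < w s. x s)" for \<theta>
      proof -
        \<comment> \<open>Raising the threshold to at least \<open>w a\<close> removes exactly
          \<open>a\<close>.\<close>
        have "{s. s \<in> insert a S \<and> max \<theta> (w a) < w s} = {s. s \<in> S \<and> \<theta> < w s}"
          using less by auto
        then show ?thesis
          using insert.prems(4)[of "max \<theta> (w a)"] by simp
      qed
      have "w a * sum x S \<le> (\<Sum>s\<in>S. w s * x s)"
        using less insert.prems by (intro insert.IH pre) (auto simp: less_imp_le intro: order_trans)
      moreover have "0 \<le> sum x (insert a S)"
      proof -
        have "{s. s \<in> insert a S \<and> w a - 1 < w s} = insert a S"
          using less by fastforce
        then show ?thesis
          using insert.prems(4)[of "w a - 1"] by simp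
      qed
      then have "m * sum x (insert a S) \<le> w a * sum x (insert a S)"
        using insert.prems(2)[of a] by (intro mult_right_mono) auto
      ultimately show ?thesis
        using False insert.hyps(1) by (simp add: algebra_simps)
    qed
  qed
  from this[of 0] show ?thesis
    using assms by simp
qed

text \<open>Abel summation for \<open>c\<close> times the indicator of \<open>B\<close> minus the
  indicator of \<open>A\<close>. It converts the cardinality bounds that growth systems and matroids
  supply into weight bounds.\<close>

lemma sum_le_if_card_thresholds_le:
  fixes w :: "'a \<Rightarrow> real"
  assumes "finite E" "inj_on w E" "\<And>e. e \<in> E \<Longrightarrow> 0 \<le> w e" "A \<subseteq> E" "B \<subseteq> E"
    and card_le: "\<And>\<theta>. card {a \<in> A. \<theta> < w a} \<le> c * card {b \<in> B. \<theta> < w b}"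
  shows "sum w A \<le> real c * sum w B"
proof -
  have split: "(\<Sum>e\<in>S. g e * (real c * of_bool (e \<in> B) - of_bool (e \<in> A)))
      = real c * sum g (S \<inter> B) - sum g (S \<inter> A)" if "S \<subseteq> E" for S and g :: "'a \<Rightarrow> real"
  proof -
    have "finite S"
      using that \<open>finite E\<close> finite_subset by blast
    moreover have "g e * (real c * of_bool (e \<in> B) - of_bool (e \<in> A))
        = real c * (if e \<in> B then g e else 0) - (if e \<in> A then g e else 0)" for e
      by (simp add: algebra_simps)
    ultimately show ?thesis
      by (simp add: sum_subtractf sum_distrib_left[symmetric] sum.inter_restrict)
  qed
  have "0 \<le> (\<Sum>e\<in>E. w e * (real c * of_bool (e \<in> B) - of_bool (e \<in> A)))"
  proof (rule weighted_sum_nonneg)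
    fix \<theta>
    have "{e. e \<in> E \<and> \<theta> < w e} \<inter> B = {b \<in> B. \<theta> < w b}" "{e. e \<in> E \<and> \<theta> < w e} \<inter> A = {a \<in> A. \<theta> < w a}"
      using assms by blast+
    then show "0 \<le> (\<Sum>e | e \<in> E \<and> \<theta> < w e. real c * of_bool (e \<in> B) - of_bool (e \<in> A))"
      using split[of "{e. e \<in> E \<and> \<theta> < w e}" "\<lambda>_. 1"] card_le[of \<theta>]
      by (simp add: of_nat_mono flip: of_nat_mult)
  qed (use assms in auto)
  also have "\<dots> = real c * sum w B - sum w A"
    using split[of E w] assms by (simp add: Int_absorb1)
  finally show ?thesis by simp
qed

lemma sum_Un_le:
  fixes w :: "'a \<Rightarrow> real"
  assumes "finite A" "finite B" "\<And>x. x \<in> A \<inter> B \<Longrightarrow> 0 \<le> w x"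
  shows "sum w (A \<union> B) \<le> sum w A + sum w B"
  using sum.union_inter[OF assms(1,2), of w] sum_nonneg[of "A \<inter> B" w] assms(3) by auto

section \<open>The greedy algorithm\<close>

lemma accept_Nil [simp]: "accept I P [] A = A"
  by (simp add: accept_def)

lemma accept_Cons [simp]:
  "accept I P (f # fs) A = accept I P fs (if P f \<and> insert f A \<in> I then insert f A else A)"
  by (simp add: accept_def)

lemma accept_append [simp]: "accept I P (fs @ gs) A = accept I P gs (accept I P fs A)"
  by (simp add: accept_def)

lemma accept_superset: "A \<subseteq> accept I P fs A"
  by (induction fs rule: rev_induct) auto

lemma accept_subset: "accept I P fs A \<subseteq> A \<union> {f \<in> set fs. P f}"
  by (induction fs rule: rev_induct) auto

lemma accept_indep: "A \<in> I \<Longrightarrow> accept I P fs A \<in> I"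
  by (induction fs arbitrary: A) auto

text \<open>The arbitrary order is absorbed by the quantifier in \<open>ins\<close>: whatever
  precedes \<open>f\<close> in the list, the set present when \<open>f\<close> is reached is one of
  these \<open>B\<close>.\<close>

lemma accept_mem:
  assumes "A \<in> I" "distinct fs" "f \<in> set fs" "P f"
    and ins: "\<And>B. B \<in> I \<Longrightarrow> B \<subseteq> A \<union> {g \<in> set fs - {f}. P g} \<Longrightarrow> insert f B \<in> I"
  shows "f \<in> accept I P fs A"
proof -
  obtain xs ys where fs: "fs = xs @ f # ys"
    using \<open>f \<in> set fs\<close> split_list by metis
  have "insert f (accept I P xs A) \<in> I"
  proof (rule ins)
    show "accept I P xs A \<subseteq> A \<union> {g \<in> set fs - {f}. P g}"
      using accept_subset[of I P xs A] \<open>distinct fs\<close> fs by auto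
  qed (rule accept_indep[OF \<open>A \<in> I\<close>])
  then show ?thesis
    using \<open>P f\<close> accept_superset[of "insert f (accept I P xs A)" I P ys] by (simp add: fs)
qed

lemma (in linorder) sorted_key_list_of_set_props:
  assumes "finite X" "inj_on f X"
  shows "set (sorted_key_list_of_set f X) = X"
    and "sorted_wrt (\<lambda>x y. f x < f y) (sorted_key_list_of_set f X)"
proof -
  interpret folding_insort_key "(\<le>)" "(<)" X f
    by standard fact
  show "set (sorted_key_list_of_set f X) = X"
    by (rule set_sorted_key_list_of_set[OF subset_refl assms(1)])
  show "sorted_wrt (\<lambda>x y. f x < f y) (sorted_key_list_of_set f X)"
    using strict_sorted_key_list_of_set[of X] unfolding sorted_wrt_map by blast
qed

lemma desc_list_props:
  assumes "finite X" "inj_on w X"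
  shows "set (desc_list w X) = X" "sorted_wrt (\<lambda>x y. w y < w x) (desc_list w X)"
  using sorted_key_list_of_set_props[OF assms] by (simp_all add: desc_list_def sorted_wrt_rev)

text \<open>A description of the greedy result without lists. It determines \<open>G\<close> by
  recursion from heavy to light, which makes the results on different ground sets
  comparable.\<close>

definition greedy_solution :: "'a set set \<Rightarrow> ('a \<Rightarrow> real) \<Rightarrow> 'a set \<Rightarrow> 'a set \<Rightarrow> bool" where
  "greedy_solution I w X G \<longleftrightarrow>
     G \<subseteq> X \<and> G \<in> I \<and> (\<forall>y\<in>X. y \<in> G \<longleftrightarrow> insert y {g \<in> G. w y < w g} \<in> I)"

lemma greedy_solution_accept:
  assumes "{} \<in> I" "sorted_wrt (\<lambda>x y. w y < w x) xs"
  shows "greedy_solution I w (set xs) (accept I (\<lambda>_. True) xs {})"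
  using assms(2)
proof (induction xs rule: rev_induct)
  case Nil
  then show ?case
    using \<open>{} \<in> I\<close> by (simp add: greedy_solution_def)
next
  case (snoc x xs)
  define G where "G = accept I (\<lambda>_. True) xs {}"
  define G' where "G' = (if insert x G \<in> I then insert x G else G)"
  have heavier: "w x < w y" if "y \<in> set xs" for y
    using snoc.prems that by (simp add: sorted_wrt_append)
  have G: "G \<subseteq> set xs" "G \<in> I" "\<And>y. y \<in> set xs \<Longrightarrow> y \<in> G \<longleftrightarrow> insert y {g \<in> G. w y < w g} \<in> I"
    using snoc unfolding G_def greedy_solution_def by (simp_all add: sorted_wrt_append)
  have "{g \<in> G'. w x < w g} = G"
    using G(1) heavier unfolding G'_def by auto
  moreover have "{g \<in> G'. w y < w g} = {g \<in> G. w y < w g}" if "y \<in> set xs" for y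
    using heavier[OF that] unfolding G'_def by auto
  moreover have "x \<notin> set xs"
    using heavier by blast
  ultimately have "greedy_solution I w (set (xs @ [x])) G'"
    using G unfolding greedy_solution_def G'_def by auto
  moreover have "accept I (\<lambda>_. True) (xs @ [x]) {} = G'"
    by (simp add: G'_def G_def)
  ultimately show ?case
    by simp
qed

text \<open>A greedy decision looks only at heavier elements, so induction on the number of heavier
  elements in the two ground sets applies.\<close>

lemma greedy_solution_cong:
  assumes "finite X" "finite X'"
    and G: "greedy_solution I w X G" and G': "greedy_solution I w X' G'"
    and agree: "\<And>x. \<theta> \<le> w x \<Longrightarrow> x \<in> X \<longleftrightarrow> x \<in> X'"
    and "\<theta> \<le> w x"
  shows "x \<in> G \<longleftrightarrow> x \<in> G'"
  using \<open>\<theta> \<le> w x\<close>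
proof (induction "card {z \<in> X \<union> X'. w x < w z}" arbitrary: x rule: less_induct)
  case less
  have sub: "G \<subseteq> X" "G' \<subseteq> X'"
    using G G' unfolding greedy_solution_def by auto
  have "y \<in> G \<longleftrightarrow> y \<in> G'" if "w x < w y" for y
  proof (cases "y \<in> X \<union> X'")
    case True
    then have "{z \<in> X \<union> X'. w y < w z} \<subset> {z \<in> X \<union> X'. w x < w z}"
      using that by force
    then have "card {z \<in> X \<union> X'. w y < w z} < card {z \<in> X \<union> X'. w x < w z}"
      using assms(1,2) by (intro psubset_card_mono) auto
    then show ?thesis
      using less.hyps less.prems that by simp
  next
    case False
    then show ?thesis
      using sub by blast
  qed
  then have eq: "{g \<in> G. w x < w g} = {g \<in> G'. w x < w g}"
    by blast
  show ?case
  proof (cases "x \<in> X")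
    case True
    then have "x \<in> X'"
      using agree less.prems by blast
    with True show ?thesis
      using G G' eq unfolding greedy_solution_def by metis
  next
    case False
    then have "x \<notin> X'"
      using agree less.prems by blast
    with False show ?thesis
      using sub by blast
  qed
qed

section \<open>Greedy choices as a function of the sample\<close>

locale weighted_indep_system =
  fixes E :: "'a set" and I :: "'a set set" and w :: "'a \<Rightarrow> real"
  assumes sys: "indep_system E I" and w_inj: "inj_on w E"
begin

lemma finite_E: "finite E"
  by (rule indep_system_finite[OF sys])

lemma greedy_solution_greedy:
  assumes "X \<subseteq> E"
  shows "greedy_solution I w X (greedy I w X)"
proof -
  have "finite X" "inj_on w X"
    using assms finite_E w_inj by (auto intro: finite_subset inj_on_subset)
  then show ?thesis
    using greedy_solution_accept[OF indep_system_empty[OF sys], of w "desc_list w X"]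
    by (simp add: desc_list_props greedy_def)
qed

text \<open>\<open>greedy\<close> and \<open>rel\<close> are the parts of \<open>chosen Y\<close> inside and outside \<open>Y\<close>.\<close>

definition chosen :: "'a set \<Rightarrow> 'a set" where
  "chosen Y = {y \<in> E. y \<in> greedy I w (insert y Y)}"

lemma chosen_subset: "chosen Y \<subseteq> E"
  by (auto simp: chosen_def)

lemma rel_eq_chosen: "rel E I w Y = chosen Y - Y"
  by (auto simp: chosen_def rel_def)

lemma greedy_eq_chosen:
  assumes "Y \<subseteq> E"
  shows "greedy I w Y = chosen Y \<inter> Y"
proof -
  have "greedy I w Y \<subseteq> Y"
    using greedy_solution_greedy[OF assms] by (simp add: greedy_solution_def)
  then show ?thesis
    using assms by (auto simp: chosen_def insert_absorb)
qed

text \<open>Agreement strictly above \<open>w y\<close> suffices: by injectivity the only element of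
  weight \<open>w y\<close> is \<open>y\<close>, which is inserted on both sides. This is what makes
  the choice of \<open>y\<close> independent of whether \<open>y\<close> was sampled.\<close>

lemma chosen_cong:
  assumes "Y \<subseteq> E" "Y' \<subseteq> E" and agree: "\<And>x. w y < w x \<Longrightarrow> x \<in> Y \<longleftrightarrow> x \<in> Y'"
  shows "y \<in> chosen Y \<longleftrightarrow> y \<in> chosen Y'"
proof (cases "y \<in> E")
  case True
  have "y \<in> greedy I w (insert y Y) \<longleftrightarrow> y \<in> greedy I w (insert y Y')"
  proof (rule greedy_solution_cong[of "insert y Y" "insert y Y'" I w _ _ "w y"])
    show "finite (insert y Y)" "finite (insert y Y')"
      using assms finite_E finite_subset by auto
    show "greedy_solution I w (insert y Y) (greedy I w (insert y Y))"
      "greedy_solution I w (insert y Y') (greedy I w (insert y Y'))"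
      using True assms by (auto intro: greedy_solution_greedy)
    show "x \<in> insert y Y \<longleftrightarrow> x \<in> insert y Y'" if "w y \<le> w x" for x
    proof (cases "w x = w y")
      case eq: True
      have "x = y" if "x \<in> E"
        using inj_onD[OF w_inj eq that \<open>y \<in> E\<close>] .
      then show ?thesis
        using assms(1,2) by blast
    next
      case False
      then show ?thesis
        using that agree[of x] by auto
    qed
  qed simp
  then show ?thesis
    using True by (simp add: chosen_def)
next
  case False
  then show ?thesis
    by (simp add: chosen_def)
qed

text \<open>Inserting \<open>y\<close> changes no decision about heavier elements, so the greedy
  criterion on \<open>insert y Y\<close> can be read off from the greedy result on
  \<open>Y\<close>.\<close>

lemma chosen_iff:
  assumes "Y \<subseteq> E" "y \<in> E"
  shows "y \<in> chosen Y \<longleftrightarrow> insert y {g \<in> chosen Y \<inter> Y. w y < w g} \<in> I"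
proof -
  have sub: "insert y Y \<subseteq> E"
    using assms by blast
  have "x \<in> chosen (insert y Y) \<longleftrightarrow> x \<in> chosen Y" if "w y < w x" for x
    using that sub assms by (intro chosen_cong) auto
  then have "{g \<in> chosen (insert y Y) \<inter> insert y Y. w y < w g} = {g \<in> chosen Y \<inter> Y. w y < w g}"
    by auto
  moreover have "y \<in> chosen (insert y Y) \<longleftrightarrow> y \<in> chosen Y"
    using assms by (simp add: chosen_def)
  ultimately show ?thesis
    using greedy_solution_greedy[OF sub] unfolding greedy_eq_chosen[OF sub] greedy_solution_def
    by simp
qed

lemma chosen_indep:
  assumes "Y \<subseteq> E"
  shows "chosen Y \<inter> Y \<in> I"
  using greedy_solution_greedy[OF assms] unfolding greedy_eq_chosen[OF assms] greedy_solution_def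
  by simp

end

section \<open>Executions of the algorithm\<close>

lemma rounds_indep:
  "(U, A) \<in> rounds H I w R D es s \<Longrightarrow> snd s \<in> I \<Longrightarrow> A \<in> I"
proof (induction es arbitrary: D s)
  case Nil
  then show ?case by auto
next
  case (Cons e es)
  from Cons.prems(1) obtain fs where
    "(U, A) \<in> rounds H I w R (insert e D) es
      (fst s - set fs, accept I (\<lambda>f. f \<in> R \<and> w e < w f) fs (snd s))"
    unfolding rounds.simps by blast
  from Cons.IH[OF this] show ?case
    using Cons.prems(2) by (simp add: accept_indep)
qed

lemma outcomes_indep:
  assumes "{} \<in> I" "X \<in> outcomes H E I w Y S1 S2"
  shows "X \<in> I"
proof -
  obtain fs U A where run: "(U, A) \<in> rounds H I w (rel E I w Y) {} (desc_list w (rel E I w Y \<inter> S1)) (S2, {})"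
      and X: "X = accept I (\<lambda>f. f \<in> rel E I w Y) fs A"
    using assms(2) unfolding outcomes_def by blast
  show ?thesis
    unfolding X using rounds_indep[OF run] \<open>{} \<in> I\<close> by (simp add: accept_indep)
qed

text \<open>When \<open>f\<close> is revealed in the round of \<open>e\<close>, all accepted elements are in \<open>T\<close> and heavier than \<open>e\<close>. If
  they spanned \<open>f\<close>, then so would the elements of \<open>V\<close> heavier than \<open>e\<close>, and \<open>f\<close> would have been
  revealed earlier.\<close>

lemma rounds_secure:
  assumes H_mono: "\<And>X Y. X \<subseteq> Y \<Longrightarrow> H X \<subseteq> H Y"
    and H_span: "\<And>B. B \<in> I \<Longrightarrow> insert f B \<notin> I \<Longrightarrow> f \<in> H B"
    and T: "T = R \<inter> S2 - {f}"
    and dominate: "\<And>\<theta>. f \<in> H {x \<in> T. \<theta> < w x} \<Longrightarrow> f \<in> H {x \<in> V. \<theta> < w x}"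
    and good: "f \<notin> H {x \<in> V. w f < w x}"
    and f: "f \<in> R" "\<And>x. x \<in> V \<Longrightarrow> w x \<noteq> w f"
    and run: "(U', A') \<in> rounds H I w R D es (U, A)"
    and es: "D \<union> set es = V" "sorted_wrt (\<lambda>x y. w y < w x) es" "\<And>d e. d \<in> D \<Longrightarrow> e \<in> set es \<Longrightarrow> w e < w d"
    and "U \<subseteq> S2" "A \<in> I"
    and inv: "f \<in> A \<or> f \<in> U \<and> f \<notin> H D \<and> A \<subseteq> {g \<in> T. \<exists>d\<in>D. w d < w g}"
  shows "U' \<subseteq> S2 \<and> (f \<in> A' \<or> f \<in> U' \<and> f \<notin> H V \<and> A' \<subseteq> T)"
  using run es \<open>U \<subseteq> S2\<close> \<open>A \<in> I\<close> inv
proof (induction es arbitrary: D U A)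
  case Nil
  then show ?case by auto
next
  case (Cons e es)
  let ?P = "\<lambda>f. f \<in> R \<and> w e < w f"
  obtain fs where fs: "distinct fs" "set fs = U \<inter> H (insert e D)"
      "(U', A') \<in> rounds H I w R (insert e D) es (U - set fs, accept I ?P fs A)"
    using Cons.prems(1) by auto
  have "f \<in> accept I ?P fs A \<or>
      f \<in> U - set fs \<and> f \<notin> H (insert e D) \<and>
      accept I ?P fs A \<subseteq> {g \<in> T. \<exists>d\<in>insert e D. w d < w g}"
  proof (cases "f \<in> A")
    case True
    then have "f \<in> accept I ?P fs A"
      using accept_superset[of A I ?P fs] by blast
    then show ?thesis ..
  next
    case False
    then have f_inv: "f \<in> U" "f \<notin> H D" "A \<subseteq> {g \<in> T. \<exists>d\<in>D. w d < w g}"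
      using Cons.prems(7) by auto
    show ?thesis
    proof (cases "f \<in> H (insert e D)")
      case True
      \<comment> \<open>Being revealed now, \<open>f\<close> must pass the weight test of this
        round. Otherwise all of \<open>insert e D\<close> would be heavier than \<open>f\<close> and
        would span it, contrary to \<open>good\<close>.\<close>
      have "w e < w f"
      proof (rule ccontr)
        assume "\<not> w e < w f"
        then have "w f < w e"
          using f(2)[of e] Cons.prems(2) by auto
        then have "insert e D \<subseteq> {x \<in> V. w f < w x}"
          using Cons.prems(2,4) by force
        then show False
          using H_mono[of "insert e D" "{x \<in> V. w f < w x}"] True good by blast
      qed
      moreover have "insert f B \<in> I"
        if "B \<in> I" "B \<subseteq> A \<union> {g \<in> set fs - {f}. ?P g}" for B
      proof (rule ccontr)
        assume "insert f B \<notin> I"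
        then have "f \<in> H B"
          by (rule H_span[OF that(1)])
        \<comment> \<open>Elements accepted earlier outweigh some \<open>d\<close> in
          \<open>D\<close>, and hence \<open>e\<close>, because the rounds go by decreasing weight.
          Those of this round have passed its weight test.\<close>
        moreover have "B \<subseteq> {x \<in> T. w e < w x}"
          using that(2) f_inv(3) Cons.prems(4,5) fs(2) unfolding T by force
        ultimately have "f \<in> H {x \<in> T. w e < w x}"
          using H_mono[of B "{x \<in> T. w e < w x}"] by blast
        then have "f \<in> H {x \<in> V. w e < w x}"
          by (rule dominate)
        moreover have "{x \<in> V. w e < w x} \<subseteq> D"
          using Cons.prems(2,3) by auto
        ultimately show False
          using H_mono[of "{x \<in> V. w e < w x}" D] f_inv(2) by blast
      qed
      ultimately have "f \<in> accept I ?P fs A"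
        using True f_inv f(1) fs Cons.prems(6) by (intro accept_mem) auto
      then show ?thesis ..
    next
      case False
      have "accept I ?P fs A \<subseteq> {g \<in> T. \<exists>d\<in>insert e D. w d < w g}"
        using accept_subset[of I ?P fs A] f_inv(3) fs(2) Cons.prems(5) False unfolding T by blast
      then show ?thesis
        using False f_inv(1) fs(2) by blast
    qed
  qed
  moreover have "insert e D \<union> set es = V"
    using Cons.prems(2) by auto
  moreover have "sorted_wrt (\<lambda>x y. w y < w x) es" "\<And>d e'. d \<in> insert e D \<Longrightarrow> e' \<in> set es \<Longrightarrow> w e' < w d"
    using Cons.prems(3,4) by auto
  ultimately show ?case
    using Cons.prems(5,6) by (intro Cons.IH[OF fs(3)] accept_indep) auto
qed

text \<open>Adds the final pass to \<open>rounds_secure\<close>. If \<open>f\<close> is still unseen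
  then, \<open>V\<close> does not span it; a blocking set would lie in \<open>T\<close> and, by
  domination, force \<open>V\<close> to span \<open>f\<close>.\<close>

lemma outcomes_secure:
  assumes H_mono: "\<And>X Y. X \<subseteq> Y \<Longrightarrow> H X \<subseteq> H Y"
    and H_span: "\<And>B. B \<in> I \<Longrightarrow> insert f B \<notin> I \<Longrightarrow> f \<in> H B"
    and "{} \<in> I" "finite E" "inj_on w E" "\<And>e. e \<in> E \<Longrightarrow> 0 \<le> w e"
    and dominate: "\<And>\<theta>. f \<in> H {x \<in> rel E I w Y \<inter> S2 - {f}. \<theta> < w x} \<Longrightarrow>
      f \<in> H {x \<in> rel E I w Y \<inter> S1. \<theta> < w x}"
    and good: "f \<notin> H {x \<in> rel E I w Y. w f < w x}"
    and f: "f \<in> rel E I w Y" "f \<in> S2" "f \<notin> S1"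
    and X: "X \<in> outcomes H E I w Y S1 S2"
  shows "f \<in> X"
proof -
  define R where "R = rel E I w Y"
  define V T where "V = R \<inter> S1" and "T = R \<inter> S2 - {f}"
  have "R \<subseteq> E"
    by (auto simp: R_def rel_def)
  have inj: "inj_on w V" and "finite V"
    using \<open>R \<subseteq> E\<close> unfolding V_def
    by (auto intro: inj_on_subset[OF \<open>inj_on w E\<close>] finite_subset[OF _ \<open>finite E\<close>])
  have ne: "w x \<noteq> w f" if "x \<in> V" for x
    using that f \<open>R \<subseteq> E\<close> inj_onD[OF \<open>inj_on w E\<close>, of x f] unfolding V_def R_def by auto
  have dom: "\<And>\<theta>. f \<in> H {x \<in> T. \<theta> < w x} \<Longrightarrow> f \<in> H {x \<in> V. \<theta> < w x}"
    using dominate unfolding T_def V_def R_def .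
  have "{x \<in> V. w f < w x} \<subseteq> {x \<in> rel E I w Y. w f < w x}"
    by (auto simp: V_def R_def)
  then have V_good: "f \<notin> H {x \<in> V. w f < w x}"
    using good H_mono[of "{x \<in> V. w f < w x}" "{x \<in> rel E I w Y. w f < w x}"] by blast
  then have "f \<notin> H {}"
    using H_mono[of "{}" "{x \<in> V. w f < w x}"] by blast
  obtain fs U A where run: "(U, A) \<in> rounds H I w R {} (desc_list w V) (S2, {})"
      and fs: "distinct fs" "set fs = U" and X_eq: "X = accept I (\<lambda>f. f \<in> R) fs A"
    using X unfolding outcomes_def R_def V_def by auto
  have "A \<in> I"
    using rounds_indep[OF run] \<open>{} \<in> I\<close> by simp
  have "U \<subseteq> S2 \<and> (f \<in> A \<or> f \<in> U \<and> f \<notin> H V \<and> A \<subseteq> T)"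
  proof (rule rounds_secure[OF _ _ T_def _ V_good _ ne run])
    show "f \<in> R" "f \<in> {} \<or> f \<in> S2 \<and> f \<notin> H {} \<and> {} \<subseteq> {g \<in> T. \<exists>d\<in>{}. w d < w g}"
      using f \<open>f \<notin> H {}\<close> by (auto simp: R_def)
  qed (use H_mono H_span dom \<open>{} \<in> I\<close> desc_list_props[OF \<open>finite V\<close> inj] in auto)
  then consider "f \<in> A" | "U \<subseteq> S2" "f \<in> U" "f \<notin> H V" "A \<subseteq> T"
    by blast
  then show ?thesis
  proof cases
    case 1
    then show ?thesis
      using accept_superset[of A] unfolding X_eq by blast
  next
    case 2
    have "insert f B \<in> I" if "B \<in> I" "B \<subseteq> A \<union> {g \<in> set fs - {f}. g \<in> R}" for B
    proof (rule ccontr)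
      assume "insert f B \<notin> I"
      then have "f \<in> H B"
        by (rule H_span[OF that(1)])
      \<comment> \<open>Weights are nonnegative, so the threshold \<open>-1\<close> lies below all
        of them and domination applies to the whole sets.\<close>
      moreover have "- 1 < w x" if "x \<in> T" for x
        using assms(6)[of x] that \<open>R \<subseteq> E\<close> unfolding T_def by auto
      then have "B \<subseteq> {x \<in> T. -1 < w x}"
        using that(2) 2 fs unfolding T_def by blast
      ultimately have "f \<in> H {x \<in> T. -1 < w x}"
        using H_mono[of B "{x \<in> T. -1 < w x}"] by blast
      then have "f \<in> H {x \<in> V. -1 < w x}"
        by (rule dom)
      moreover have "H {x \<in> V. -1 < w x} \<subseteq> H V"
        by (rule H_mono) blast
      ultimately show False
        using 2(3) by blast
    qed
    then show ?thesis
      unfolding X_eq using accept_mem[OF \<open>A \<in> I\<close> fs(1), of f "\<lambda>f. f \<in> R"] f(1) 2(2) fs(2)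
      by (simp add: R_def)
  qed
qed

section \<open>Combinations of growth systems\<close>

lemma comb_indep_system:
  assumes "\<And>j. j \<in> {1..M} \<Longrightarrow> indep_system (Sj j) (Ij j)"
  shows "indep_system (comb_ground M Sj) (comb_indep M Sj Ij)"
  unfolding indep_system_def
proof (intro conjI ballI allI impI)
  show "finite (comb_ground M Sj)"
    using assms indep_system_finite unfolding comb_ground_def by blast
  show "comb_indep M Sj Ij \<subseteq> Pow (comb_ground M Sj)"
    by (auto simp: comb_indep_def)
  have "{} \<in> comb_indep M Sj Ij"
    using assms[THEN indep_system_empty] by (simp add: comb_indep_def)
  then show "comb_indep M Sj Ij \<noteq> {}"
    by blast
  fix A B assume AB: "A \<in> comb_indep M Sj Ij" "B \<subseteq> A"
  have "B \<inter> Sj j \<in> Ij j" if j: "j \<in> {1..M}" for j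
  proof (rule indep_system_subset[OF assms[OF j]])
    show "A \<inter> Sj j \<in> Ij j"
      using AB(1) j by (simp add: comb_indep_def)
  qed (use AB(2) in blast)
  then show "B \<in> comb_indep M Sj Ij"
    using AB by (auto simp: comb_indep_def)
qed

locale growth_combination =
  fixes M k :: nat and Sj :: "nat \<Rightarrow> 'a set" and Ij :: "nat \<Rightarrow> 'a set set"
    and kj :: "nat \<Rightarrow> nat" and w :: "'a \<Rightarrow> real"
  assumes growth: "\<And>j. j \<in> {1..M} \<Longrightarrow> growth_system (kj j) (Sj j) (Ij j)"
    and w_nonneg: "\<And>e. e \<in> comb_ground M Sj \<Longrightarrow> 0 \<le> w e"
    and inj_w: "inj_on w (comb_ground M Sj)"
    and k_pos: "0 < k"
    and k_bound: "\<And>e. e \<in> comb_ground M Sj \<Longrightarrow> (\<Sum>j | j \<in> {1..M} \<and> e \<in> Sj j. kj j) \<le> k"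
begin

abbreviation "E \<equiv> comb_ground M Sj"
abbreviation "I \<equiv> comb_indep M Sj Ij"
abbreviation "Hull \<equiv> hull_comb M Sj Ij"

lemma component: "j \<in> {1..M} \<Longrightarrow> indep_system (Sj j) (Ij j)"
  by (rule growth_system_indep[OF growth])

sublocale weighted_indep_system E I w
  by standard (use comb_indep_system component inj_w in auto)

lemma component_subset: "j \<in> {1..M} \<Longrightarrow> Sj j \<subseteq> E"
  by (auto simp: comb_ground_def)

lemma component_indep: "A \<in> I \<Longrightarrow> j \<in> {1..M} \<Longrightarrow> A \<inter> Sj j \<in> Ij j"
  by (simp add: comb_indep_def)

lemma component_dependent:
  assumes "B \<in> I" "f \<in> E" "insert f B \<notin> I"
  obtains j where "j \<in> {1..M}" "f \<in> Sj j" "insert f (B \<inter> Sj j) \<notin> Ij j"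
proof -
  have "insert f B \<subseteq> E"
    using assms by (auto simp: comb_indep_def)
  then obtain j where j: "j \<in> {1..M}" "insert f B \<inter> Sj j \<notin> Ij j"
    using assms(3) by (auto simp: comb_indep_def)
  then have "f \<in> Sj j"
    using component_indep[OF assms(1) j(1)] by (metis Int_insert_left)
  then show ?thesis
    using that[of j] j by simp
qed

lemma hull_mono: "X \<subseteq> Y \<Longrightarrow> Hull X \<subseteq> Hull Y"
  unfolding hull_comb_def by (intro UN_mono phull_mono) auto

lemma hull_spans:
  assumes "B \<in> I" "f \<in> E" "insert f B \<notin> I"
  shows "f \<in> Hull B"
proof -
  obtain j where j: "j \<in> {1..M}" "f \<in> Sj j" "insert f (B \<inter> Sj j) \<notin> Ij j"
    using component_dependent[OF assms] .
  then show ?thesis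
    using mem_phullI[OF component[OF j(1)] component_indep[OF assms(1) j(1)]]
    unfolding hull_comb_def by blast
qed

text \<open>The hull is split by components so that each component can be bounded with its own
  constant \<open>kj j\<close>.\<close>

definition spanned :: "nat \<Rightarrow> 'a \<Rightarrow> 'a set \<Rightarrow> bool" where
  "spanned j f X \<longleftrightarrow> f \<in> phull (Sj j) (Ij j) (X \<inter> Sj j)"

lemma spanned_ground: "spanned j f X \<Longrightarrow> f \<in> Sj j"
  by (auto simp: spanned_def phull_def)

lemma hull_iff_spanned: "f \<in> Hull X \<longleftrightarrow> (\<exists>j\<in>{1..M}. spanned j f X)"
  by (simp add: hull_comb_def spanned_def)

text \<open>Double counting: after swapping the sums, each element carries the total of
  \<open>kj\<close> over the components containing it, which is at most \<open>k\<close>.\<close>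

lemma sum_components_le:
  fixes g :: "'a \<Rightarrow> real"
  assumes "X \<subseteq> E" "\<And>e. e \<in> X \<Longrightarrow> 0 \<le> g e"
  shows "(\<Sum>j\<in>{1..M}. real (kj j) * sum g (X \<inter> Sj j)) \<le> real k * sum g X"
proof -
  have "finite X"
    using finite_subset[OF assms(1) finite_E] .
  then have "(\<Sum>j\<in>{1..M}. real (kj j) * sum g (X \<inter> Sj j))
      = (\<Sum>j\<in>{1..M}. \<Sum>e\<in>X. (if e \<in> Sj j then real (kj j) else 0) * g e)"
    by (intro sum.cong refl) (auto simp: sum.inter_restrict sum_distrib_left intro!: sum.cong)
  also have "\<dots> = (\<Sum>e\<in>X. (\<Sum>j\<in>{1..M}. if e \<in> Sj j then real (kj j) else 0) * g e)"
    by (subst sum.swap) (simp add: sum_distrib_right)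
  also have "\<dots> = (\<Sum>e\<in>X. real (\<Sum>j | j \<in> {1..M} \<and> e \<in> Sj j. kj j) * g e)"
    by (simp add: sum.If_cases Int_def)
  also have "\<dots> \<le> (\<Sum>e\<in>X. real k * g e)"
    using assms k_bound by (intro sum_mono mult_right_mono of_nat_mono) auto
  finally show ?thesis
    by (simp add: sum_distrib_left)
qed

text \<open>Above each threshold, an element of \<open>A\<close> missed by greedy is blocked by
  \<open>G\<close> within some component. The growth property charges the elements blocked there to
  elements of \<open>G - A'\<close> in that component, and over all components each of these is
  charged at most \<open>k\<close> times.\<close>

lemma greedy_approximation:
  assumes "Y \<subseteq> E" "A \<in> I" "A \<subseteq> Y"
  shows "sum w A \<le> real k * sum w (chosen Y \<inter> Y)"
proof (rule sum_le_if_card_thresholds_le[OF finite_E inj_w w_nonneg])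
  show "A \<subseteq> E" "chosen Y \<inter> Y \<subseteq> E"
    using assms by auto
  fix \<theta>
  define G where "G = {g \<in> chosen Y \<inter> Y. \<theta> < w g}"
  define A' where "A' = {a \<in> A. \<theta> < w a}"
  define D where "D j = {a \<in> A' - G. a \<in> Sj j \<and> insert a (G \<inter> Sj j) \<notin> Ij j}" for j
  have "G \<in> I"
    by (rule indep_system_subset[OF sys chosen_indep[OF \<open>Y \<subseteq> E\<close>]]) (auto simp: G_def)
  have "A' \<in> I"
    by (rule indep_system_subset[OF sys \<open>A \<in> I\<close>]) (auto simp: A'_def)
  have fin: "finite A'" "finite G"
    using finite_subset[OF indep_system_ground[OF sys] finite_E] \<open>A' \<in> I\<close> \<open>G \<in> I\<close> by auto
  have D_cover: "A' - G \<subseteq> (\<Union>j\<in>{1..M}. D j)"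
  proof
    fix a assume a: "a \<in> A' - G"
    then have "a \<in> E" "a \<notin> chosen Y" "\<theta> < w a"
      using assms by (auto simp: A'_def G_def)
    \<comment> \<open>\<open>G\<close> contains every greedy element heavier than \<open>a\<close>,
      and these already block \<open>a\<close>.\<close>
    have "insert a G \<notin> I"
    proof
      assume "insert a G \<in> I"
      then have "insert a {g \<in> chosen Y \<inter> Y. w a < w g} \<in> I"
        by (rule indep_system_subset[OF sys]) (use \<open>\<theta> < w a\<close> in \<open>auto simp: G_def\<close>)
      then show False
        using chosen_iff[OF \<open>Y \<subseteq> E\<close> \<open>a \<in> E\<close>] \<open>a \<notin> chosen Y\<close> by blast
    qed
    then obtain j where "j \<in> {1..M}" "a \<in> Sj j" "insert a (G \<inter> Sj j) \<notin> Ij j"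
      using component_dependent[OF \<open>G \<in> I\<close> \<open>a \<in> E\<close>] by metis
    then show "a \<in> (\<Union>j\<in>{1..M}. D j)"
      using a by (auto simp: D_def)
  qed
  have "card (D j) \<le> kj j * card ((G - A') \<inter> Sj j)" if j: "j \<in> {1..M}" for j
  proof -
    have "card (D j) \<le> kj j * card (G \<inter> Sj j - A' \<inter> Sj j)"
    proof (rule growth_system_card_dependent[OF growth[OF j]])
      show "G \<inter> Sj j \<in> Ij j" "A' \<inter> Sj j \<in> Ij j"
        using component_indep \<open>G \<in> I\<close> \<open>A' \<in> I\<close> j by blast+
    qed (auto simp: D_def)
    also have "G \<inter> Sj j - A' \<inter> Sj j = (G - A') \<inter> Sj j"
      by blast
    finally show ?thesis .
  qed
  then have "real (\<Sum>j\<in>{1..M}. card (D j)) \<le> (\<Sum>j\<in>{1..M}. real (kj j) * (\<Sum>e\<in>(G - A') \<inter> Sj j. 1))"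
    unfolding of_nat_sum by (intro sum_mono) (simp flip: of_nat_mult)
  also have "\<dots> \<le> real k * (\<Sum>e\<in>G - A'. 1)"
    using indep_system_ground[OF sys \<open>G \<in> I\<close>] by (intro sum_components_le) auto
  finally have "real (\<Sum>j\<in>{1..M}. card (D j)) \<le> real (k * card (G - A'))"
    by simp
  then have "(\<Sum>j\<in>{1..M}. card (D j)) \<le> k * card (G - A')"
    by (simp only: of_nat_le_iff)
  moreover have "card (A' - G) \<le> (\<Sum>j\<in>{1..M}. card (D j))"
  proof -
    have "finite (\<Union>j\<in>{1..M}. D j)"
      using fin by (auto simp: D_def)
    then have "card (A' - G) \<le> card (\<Union>j\<in>{1..M}. D j)"
      using D_cover card_mono by blast
    also have "\<dots> \<le> (\<Sum>j\<in>{1..M}. card (D j))"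
      by (rule card_UN_le) simp
    finally show ?thesis .
  qed
  moreover have "card (A' \<inter> G) \<le> k * card (A' \<inter> G)"
    using k_pos by simp
  ultimately have "card A' \<le> k * card (A' \<inter> G) + k * card (G - A')"
    using card_Int_Diff[OF fin(1), of G] by linarith
  also have "\<dots> = k * card G"
    using card_Int_Diff[OF fin(2), of A'] by (simp add: Int_commute add_mult_distrib2)
  finally have "card A' \<le> k * card G" .
  then show "card {a \<in> A. \<theta> < w a} \<le> k * card {b \<in> chosen Y \<inter> Y. \<theta> < w b}"
    unfolding A'_def G_def .
qed

definition rel_above :: "'a set \<Rightarrow> 'a \<Rightarrow> 'a set" where
  "rel_above Y f = {e \<in> chosen Y - Y. w f < w e}"

text \<open>The counted elements are part of the greedy result on \<open>Y\<close>, hence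
  independent in the component. They are disjoint from the relevant elements, which lie outside
  \<open>Y\<close>, and above any threshold they are spanned by relevant elements above it.\<close>

lemma component_spanned_le:
  assumes "Y \<subseteq> E" and j: "j \<in> {1..M}"
  shows "sum w {f \<in> Y. f \<in> chosen Y \<and> spanned j f (rel_above Y f)} \<le> real (kj j) * sum w ((chosen Y - Y) \<inter> Sj j)"
proof (rule sum_le_if_card_thresholds_le[OF finite_E inj_w w_nonneg])
  show "{f \<in> Y. f \<in> chosen Y \<and> spanned j f (rel_above Y f)} \<subseteq> E" "(chosen Y - Y) \<inter> Sj j \<subseteq> E"
    using chosen_subset by auto
  fix \<theta>
  define F where "F = {f \<in> {f \<in> Y. f \<in> chosen Y \<and> spanned j f (rel_above Y f)}. \<theta> < w f}"
  define X where "X = {e \<in> (chosen Y - Y) \<inter> Sj j. \<theta> < w e}"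
  have "card F \<le> kj j * card X"
  proof (rule growth_system_card_phull[OF growth[OF j]])
    have "F \<subseteq> chosen Y \<inter> Y \<inter> Sj j"
      using spanned_ground by (auto simp: F_def)
    then show "F \<in> Ij j"
      using component_indep[OF chosen_indep[OF \<open>Y \<subseteq> E\<close>] j] indep_system_subset[OF component[OF j]] by metis
    show "F \<subseteq> phull (Sj j) (Ij j) X"
    proof
      fix f assume "f \<in> F"
      moreover then have "rel_above Y f \<inter> Sj j \<subseteq> X"
        by (auto simp: F_def X_def rel_above_def)
      ultimately show "f \<in> phull (Sj j) (Ij j) X"
        using phull_mono[of "rel_above Y f \<inter> Sj j" X "Sj j" "Ij j"] unfolding F_def spanned_def by blast
    qed
  qed (auto simp: X_def F_def)
  then show "card {a \<in> {f \<in> Y. f \<in> chosen Y \<and> spanned j f (rel_above Y f)}. \<theta> < w a}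
      \<le> kj j * card {b \<in> (chosen Y - Y) \<inter> Sj j. \<theta> < w b}"
    unfolding F_def X_def .
qed

text \<open>The relevant elements pay for both sums at once: by \<open>matroid_card_phull\<close>
  the spanned greedy elements are bounded by the number of unspanned relevant ones, which leaves
  room for the spanned relevant ones.\<close>

lemma component_spanned_le_matroid:
  assumes "Y \<subseteq> E" and j: "j \<in> {1..M}" and mat: "matroid (Sj j) (Ij j)"
  shows "sum w {f \<in> Y. f \<in> chosen Y \<and> spanned j f (rel_above Y f)}
      + sum w {f \<in> E - Y. f \<in> chosen Y \<and> spanned j f (rel_above Y f)} \<le> sum w ((chosen Y - Y) \<inter> Sj j)"
proof -
  let ?F = "{f \<in> Y. f \<in> chosen Y \<and> spanned j f (rel_above Y f)}"
  let ?B = "{f \<in> E - Y. f \<in> chosen Y \<and> spanned j f (rel_above Y f)}"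
  let ?R = "(chosen Y - Y) \<inter> Sj j"
  have fin: "finite ?F" "finite ?B"
    using finite_subset[OF _ finite_E] \<open>Y \<subseteq> E\<close> by auto
  have "sum w (?F \<union> ?B) \<le> real 1 * sum w ?R"
  proof (rule sum_le_if_card_thresholds_le[OF finite_E inj_w w_nonneg])
    show "?F \<union> ?B \<subseteq> E" "?R \<subseteq> E"
      using chosen_subset by auto
    fix \<theta>
    define F where "F = {f \<in> ?F. \<theta> < w f}"
    define X where "X = {e \<in> ?R. \<theta> < w e}"
    \<comment> \<open>Restricting to elements above the threshold does not change what lies above an
      \<open>f\<close> that exceeds it.\<close>
    have up: "rel_above Y f \<inter> Sj j = {e \<in> X. w f < w e}" if "\<theta> < w f" for f
      using that by (auto simp: X_def rel_above_def)
    have "card F + card {f \<in> X. f \<in> phull (Sj j) (Ij j) {e \<in> X. w f < w e}} \<le> card X"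
    proof (rule matroid_card_phull[OF mat])
      show "inj_on w (Sj j)"
        by (rule inj_on_subset[OF inj_w component_subset[OF j]])
      have "F \<subseteq> chosen Y \<inter> Y \<inter> Sj j"
        using spanned_ground by (auto simp: F_def)
      then show "F \<in> Ij j"
        using component_indep[OF chosen_indep[OF \<open>Y \<subseteq> E\<close>] j] indep_system_subset[OF component[OF j]] by metis
      show "f \<in> phull (Sj j) (Ij j) {e \<in> X. w f < w e}" if "f \<in> F" for f
        using that up[of f] by (simp add: F_def spanned_def)
    qed (auto simp: X_def F_def)
    moreover have "{f \<in> X. f \<in> phull (Sj j) (Ij j) {e \<in> X. w f < w e}} = {f \<in> ?B. \<theta> < w f}"
    proof -
      have "f \<in> X \<and> spanned j f (rel_above Y f) \<longleftrightarrow> f \<in> ?B \<and> \<theta> < w f" for f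
        using spanned_ground chosen_subset[of Y] by (auto simp: X_def)
      moreover have "spanned j f (rel_above Y f) \<longleftrightarrow> f \<in> phull (Sj j) (Ij j) {e \<in> X. w f < w e}" if "f \<in> X" for f
        using that up[of f] by (simp add: X_def spanned_def)
      ultimately show ?thesis
        by blast
    qed
    moreover have "{a \<in> ?F \<union> ?B. \<theta> < w a} = F \<union> {f \<in> ?B. \<theta> < w f}"
      by (auto simp: F_def)
    moreover have "card (F \<union> {f \<in> ?B. \<theta> < w f}) \<le> card F + card {f \<in> ?B. \<theta> < w f}"
      by (rule card_Un_le)
    ultimately show "card {a \<in> ?F \<union> ?B. \<theta> < w a} \<le> 1 * card {b \<in> ?R. \<theta> < w b}"
      by (simp add: X_def)
  qed
  moreover have "sum w (?F \<union> ?B) = sum w ?F + sum w ?B"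
    using fin by (intro sum.union_disjoint) auto
  ultimately show ?thesis
    by simp
qed

end

section \<open>Averaging over the sample\<close>

text \<open>The expectation of \<open>h Y\<close> for a subset \<open>Y\<close> of \<open>E\<close> that contains each element independently
  with probability \<open>p\<close>.\<close>

definition sample_mean :: "real \<Rightarrow> 'a set \<Rightarrow> ('a set \<Rightarrow> real) \<Rightarrow> real" where
  "sample_mean p E h = (\<Sum>Y\<in>Pow E. p ^ card Y * (1 - p) ^ card (E - Y) * h Y)"

lemma sample_mean_const:
  assumes "finite E"
  shows "sample_mean p E (\<lambda>_. c) = c"
proof -
  have "(\<Sum>Y\<in>Pow E. p ^ card Y * (1 - p) ^ card (E - Y)) = 1"
    using prod_add[OF assms, of "\<lambda>_. p" "\<lambda>_. 1 - p"] by simp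
  then show ?thesis
    unfolding sample_mean_def by (simp flip: sum_distrib_right)
qed

lemma sample_mean_mono:
  assumes "0 \<le> p" "p \<le> 1" "\<And>Y. Y \<subseteq> E \<Longrightarrow> g Y \<le> h Y"
  shows "sample_mean p E g \<le> sample_mean p E h"
  unfolding sample_mean_def using assms by (intro sum_mono mult_left_mono) auto

lemma sample_mean_add: "sample_mean p E (\<lambda>Y. g Y + h Y) = sample_mean p E g + sample_mean p E h"
  unfolding sample_mean_def by (simp add: algebra_simps sum.distrib)

lemma sample_mean_mult: "sample_mean p E (\<lambda>Y. c * h Y) = c * sample_mean p E h"
  unfolding sample_mean_def by (simp add: algebra_simps sum_distrib_left)

lemma sample_mean_sum: "sample_mean p E (\<lambda>Y. \<Sum>i\<in>A. h i Y) = (\<Sum>i\<in>A. sample_mean p E (h i))"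
  unfolding sample_mean_def by (simp add: sum_distrib_left sum.swap[of _ A])

text \<open>Each \<open>Y\<close> without \<open>f\<close> is paired with \<open>insert f Y\<close>.
  The truth value of \<open>\<Phi>\<close> is the same on both, and their probabilities are in the
  ratio of \<open>1 - p\<close> to \<open>p\<close>.\<close>

lemma sample_mean_exchange:
  assumes "finite E" "f \<in> E" and inv: "\<And>Y. Y \<subseteq> E - {f} \<Longrightarrow> \<Phi> (insert f Y) \<longleftrightarrow> \<Phi> Y"
  shows "p * sample_mean p E (\<lambda>Y. of_bool (f \<notin> Y \<and> \<Phi> Y))
    = (1 - p) * sample_mean p E (\<lambda>Y. of_bool (f \<in> Y \<and> \<Phi> Y))"
proof -
  let ?m = "\<lambda>Y. p ^ card Y * (1 - p) ^ card (E - Y)"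
  let ?P = "Pow (E - {f})"
  have E: "Pow E = ?P \<union> insert f ` ?P"
    using Pow_insert[of f "E - {f}"] \<open>f \<in> E\<close> by (simp add: insert_absorb)
  have disj: "?P \<inter> insert f ` ?P = {}"
    by blast
  have inj: "inj_on (insert f) ?P"
    by (auto simp: inj_on_def insert_ident)
  have step: "(1 - p) * ?m (insert f Y) = p * ?m Y" if "Y \<in> ?P" for Y
  proof -
    have "finite Y" "f \<notin> Y"
      using that finite_subset[of Y E] \<open>finite E\<close> by auto
    have "E - Y = insert f (E - insert f Y)"
      using \<open>f \<in> E\<close> \<open>f \<notin> Y\<close> by blast
    then have "card (E - Y) = card (insert f (E - insert f Y))"
      by (rule arg_cong)
    also have "\<dots> = Suc (card (E - insert f Y))"
      using \<open>finite E\<close> by (intro card_insert_disjoint) auto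
    finally show ?thesis
      using \<open>finite Y\<close> \<open>f \<notin> Y\<close> by (simp add: mult_ac)
  qed
  have split: "sample_mean p E h = (\<Sum>Y\<in>?P. ?m Y * h Y) + (\<Sum>Y\<in>?P. ?m (insert f Y) * h (insert f Y))" for h
    unfolding sample_mean_def E using \<open>finite E\<close> disj
    by (subst sum.union_disjoint) (auto simp: sum.reindex[OF inj])
  have "(\<Sum>Y\<in>?P. ?m Y * of_bool (f \<in> Y \<and> \<Phi> Y)) = 0"
    by (intro sum.neutral) auto
  then have "(1 - p) * sample_mean p E (\<lambda>Y. of_bool (f \<in> Y \<and> \<Phi> Y))
      = (\<Sum>Y\<in>?P. (1 - p) * ?m (insert f Y) * of_bool (\<Phi> (insert f Y)))"
    unfolding split by (simp add: sum_distrib_left mult.assoc)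
  also have "\<dots> = (\<Sum>Y\<in>?P. p * ?m Y * of_bool (\<Phi> Y))"
    by (intro sum.cong refl) (simp add: step inv)
  also have "\<dots> = p * (\<Sum>Y\<in>?P. ?m Y * of_bool (f \<notin> Y \<and> \<Phi> Y))"
    by (auto simp: sum_distrib_left mult.assoc intro!: sum.cong)
  also have "\<dots> = p * sample_mean p E (\<lambda>Y. of_bool (f \<notin> Y \<and> \<Phi> Y))"
    unfolding split by simp
  finally show ?thesis ..
qed

lemma sample_mean_sum_Collect:
  assumes "finite E" "\<And>Y. Y \<subseteq> E \<Longrightarrow> B Y \<subseteq> E"
  shows "sample_mean p E (\<lambda>Y. sum w (B Y)) = (\<Sum>f\<in>E. w f * sample_mean p E (\<lambda>Y. of_bool (f \<in> B Y)))"
proof -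
  have "sum w (B Y) = (\<Sum>f\<in>E. w f * of_bool (f \<in> B Y))" if "Y \<subseteq> E" for Y
    using assms(2)[OF that] \<open>finite E\<close> by (simp add: Int_absorb1 Int_commute flip: sum.inter_restrict)
  then have "sample_mean p E (\<lambda>Y. sum w (B Y)) = sample_mean p E (\<lambda>Y. \<Sum>f\<in>E. w f * of_bool (f \<in> B Y))"
    unfolding sample_mean_def by (intro sum.cong) auto
  then show ?thesis
    by (simp add: sample_mean_sum sample_mean_mult)
qed

lemma sample_mean_weight_exchange:
  assumes "finite E" and inv: "\<And>f Y. f \<in> E \<Longrightarrow> Y \<subseteq> E - {f} \<Longrightarrow> \<Phi> f (insert f Y) \<longleftrightarrow> \<Phi> f Y"
  shows "p * sample_mean p E (\<lambda>Y. sum w {f \<in> E - Y. \<Phi> f Y})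
    = (1 - p) * sample_mean p E (\<lambda>Y. sum w {f \<in> Y. \<Phi> f Y})"
proof -
  have "p * sample_mean p E (\<lambda>Y. of_bool (f \<in> {f \<in> E - Y. \<Phi> f Y}))
      = (1 - p) * sample_mean p E (\<lambda>Y. of_bool (f \<in> {f \<in> Y. \<Phi> f Y}))" if "f \<in> E" for f
    using sample_mean_exchange[OF \<open>finite E\<close> that, of "\<Phi> f" p] inv[OF that] that by simp
  then show ?thesis
    using \<open>finite E\<close> by (subst (1 2) sample_mean_sum_Collect)
      (auto simp: sum_distrib_left mult.left_commute[of _ "w _"] intro!: sum.cong)
qed

section \<open>The weight of unspanned relevant elements\<close>

context growth_combination
begin

abbreviation "relevant Y \<equiv> {f \<in> E - Y. f \<in> chosen Y}"
abbreviation "unspanned Y \<equiv> {f \<in> E - Y. f \<in> chosen Y \<and> f \<notin> Hull (rel_above Y f)}"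

lemma relevant_eq: "relevant Y = chosen Y - Y"
  using chosen_subset by auto

text \<open>Only choices heavier than \<open>f\<close> enter, and these ignore whether
  \<open>f\<close> was sampled. Together with \<open>chosen_insert\<close> this gives the invariance
  that the exchange argument requires.\<close>

lemma rel_above_insert:
  assumes "Y \<subseteq> E" "f \<in> E"
  shows "rel_above (insert f Y) f = rel_above Y f"
proof -
  have "e \<in> chosen (insert f Y) \<longleftrightarrow> e \<in> chosen Y" if "w f < w e" for e
    using that assms by (intro chosen_cong) auto
  then show ?thesis
    by (auto simp: rel_above_def)
qed

lemma chosen_insert: "f \<in> chosen (insert f Y) \<longleftrightarrow> f \<in> chosen Y"
  by (simp add: chosen_def)

lemma sample_mean_inter:
  assumes "0 < p" "A \<subseteq> E"
  shows "sample_mean p E (\<lambda>Y. sum w (A \<inter> Y)) = p * sum w A"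
proof -
  have "sum w {f \<in> Y. f \<in> A} + sum w {f \<in> E - Y. f \<in> A} = sum w A" if "Y \<subseteq> E" for Y
  proof -
    have "{f \<in> Y. f \<in> A} = A \<inter> Y" "{f \<in> E - Y. f \<in> A} = A - Y"
      using assms that by auto
    moreover have "finite A"
      using finite_subset[OF \<open>A \<subseteq> E\<close> finite_E] .
    ultimately show ?thesis
      using sum.Int_Diff[of A w Y] by simp
  qed
  then have "sample_mean p E (\<lambda>Y. sum w {f \<in> Y. f \<in> A} + sum w {f \<in> E - Y. f \<in> A})
      = sample_mean p E (\<lambda>_. sum w A)"
    unfolding sample_mean_def by (intro sum.cong) auto
  then have "sample_mean p E (\<lambda>Y. sum w {f \<in> Y. f \<in> A}) + sample_mean p E (\<lambda>Y. sum w {f \<in> E - Y. f \<in> A}) = sum w A"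
    by (simp add: sample_mean_add sample_mean_const[OF finite_E])
  moreover have "p * sample_mean p E (\<lambda>Y. sum w {f \<in> E - Y. f \<in> A})
      = (1 - p) * sample_mean p E (\<lambda>Y. sum w {f \<in> Y. f \<in> A})"
    by (rule sample_mean_weight_exchange[OF finite_E]) simp
  \<comment> \<open>With \<open>x\<close> the mean weight inside and \<open>y\<close> the mean
    weight outside the sample, \<open>x + y = sum w A\<close> and \<open>p * y = (1 - p) * x\<close>
    give \<open>x = p * sum w A\<close>.\<close>
  ultimately have "p * sum w A = sample_mean p E (\<lambda>Y. sum w {f \<in> Y. f \<in> A})"
    by (simp only: distrib_left left_diff_distrib flip: \<open>_ = sum w A\<close>)
  moreover have "{f \<in> Y. f \<in> A} = A \<inter> Y" for Y
    by blast
  ultimately show ?thesis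
    by simp
qed

text \<open>The exchange turns the greedy weight inside the sample into the relevant weight outside
  it. Greedy loses at most a factor \<open>k\<close> against the sampled part of \<open>A\<close>,
  whose mean weight is \<open>p * sum w A\<close>.\<close>

lemma relevant_weight:
  assumes p: "0 < p" "p \<le> 1" and "A \<in> I"
  shows "(1 - p) * sum w A \<le> real k * sample_mean p E (\<lambda>Y. sum w (relevant Y))"
proof -
  have "p * sum w A = sample_mean p E (\<lambda>Y. sum w (A \<inter> Y))"
    using sample_mean_inter[OF p(1)] indep_system_ground[OF sys \<open>A \<in> I\<close>] by simp
  also have "\<dots> \<le> sample_mean p E (\<lambda>Y. real k * sum w {f \<in> Y. f \<in> chosen Y})"
  proof (rule sample_mean_mono)
    fix Y assume "Y \<subseteq> E"
    have "A \<inter> Y \<in> I"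
      by (rule indep_system_subset[OF sys \<open>A \<in> I\<close>]) blast
    then have "sum w (A \<inter> Y) \<le> real k * sum w (chosen Y \<inter> Y)"
      using greedy_approximation[OF \<open>Y \<subseteq> E\<close>] by simp
    also have "chosen Y \<inter> Y = {f \<in> Y. f \<in> chosen Y}"
      by blast
    finally show "sum w (A \<inter> Y) \<le> real k * sum w {f \<in> Y. f \<in> chosen Y}" .
  qed (use p in auto)
  finally have "(1 - p) * (p * sum w A) \<le> (1 - p) * (real k * sample_mean p E (\<lambda>Y. sum w {f \<in> Y. f \<in> chosen Y}))"
    using p by (intro mult_left_mono) (simp_all add: sample_mean_mult)
  also have "\<dots> = real k * (p * sample_mean p E (\<lambda>Y. sum w (relevant Y)))"
    using sample_mean_weight_exchange[OF finite_E, of "\<lambda>f Y. f \<in> chosen Y" p w] chosen_insert by simp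
  finally have "p * ((1 - p) * sum w A) \<le> p * (real k * sample_mean p E (\<lambda>Y. sum w (relevant Y)))"
    by (simp add: mult_ac)
  then show ?thesis
    using p by simp
qed

abbreviation "spanned_outside Y \<equiv>
  \<Sum>j\<in>{1..M}. sum w {f \<in> E - Y. f \<in> chosen Y \<and> spanned j f (rel_above Y f)}"
abbreviation "spanned_inside Y \<equiv>
  \<Sum>j\<in>{1..M}. sum w {f \<in> Y. f \<in> chosen Y \<and> spanned j f (rel_above Y f)}"

lemma spanned_exchange:
  "p * sample_mean p E (\<lambda>Y. spanned_outside Y) = (1 - p) * sample_mean p E (\<lambda>Y. spanned_inside Y)"
proof -
  have "p * sample_mean p E (\<lambda>Y. sum w {f \<in> E - Y. f \<in> chosen Y \<and> spanned j f (rel_above Y f)})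
      = (1 - p) * sample_mean p E (\<lambda>Y. sum w {f \<in> Y. f \<in> chosen Y \<and> spanned j f (rel_above Y f)})" for j
  proof (rule sample_mean_weight_exchange[OF finite_E])
    fix f Y assume "f \<in> E" "Y \<subseteq> E - {f}"
    then have "rel_above (insert f Y) f = rel_above Y f"
      by (intro rel_above_insert) auto
    then show "f \<in> chosen (insert f Y) \<and> spanned j f (rel_above (insert f Y) f)
        \<longleftrightarrow> f \<in> chosen Y \<and> spanned j f (rel_above Y f)"
      by (simp add: chosen_insert)
  qed
  then show ?thesis
    by (simp only: sample_mean_sum sum_distrib_left)
qed

text \<open>A union bound over the components: an element spanned in several of them is counted
  repeatedly, which is harmless for nonnegative weights.\<close>

lemma relevant_le_unspanned:
  assumes "Y \<subseteq> E"
  shows "sum w (relevant Y) \<le> sum w (unspanned Y) + spanned_outside Y"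
proof -
  let ?S = "\<lambda>j. {f \<in> E - Y. f \<in> chosen Y \<and> spanned j f (rel_above Y f)}"
  have fin: "finite (\<Union>j\<in>{1..M}. ?S j)" "finite (unspanned Y)"
    using finite_E by auto
  have "relevant Y = unspanned Y \<union> (\<Union>j\<in>{1..M}. ?S j)"
    by (auto simp: hull_iff_spanned)
  then have "sum w (relevant Y) \<le> sum w (unspanned Y) + sum w (\<Union>j\<in>{1..M}. ?S j)"
    using sum_Un_le[OF fin(2,1), of w] w_nonneg by auto
  moreover have "sum w (\<Union>j\<in>{1..M}. ?S j) \<le> (\<Sum>x\<in>Sigma {1..M} ?S. w (snd x))"
  proof (rule sum_le_included[where i = snd])
    show "\<forall>x\<in>\<Union>j\<in>{1..M}. ?S j. \<exists>y\<in>Sigma {1..M} ?S. snd y = x \<and> w x \<le> w (snd y)"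
    proof
      fix x assume "x \<in> (\<Union>j\<in>{1..M}. ?S j)"
      then obtain j where "(j, x) \<in> Sigma {1..M} ?S"
        by blast
      then show "\<exists>y\<in>Sigma {1..M} ?S. snd y = x \<and> w x \<le> w (snd y)"
        by (intro bexI[of _ "(j, x)"]) auto
    qed
    show "finite (Sigma {1..M} ?S)"
      using finite_E by (intro finite_SigmaI) auto
    show "\<forall>y\<in>Sigma {1..M} ?S. 0 \<le> w (snd y)"
      using w_nonneg by auto
  qed (rule fin(1))
  moreover have "(\<Sum>x\<in>Sigma {1..M} ?S. w (snd x)) = spanned_outside Y"
    using finite_E by (simp add: sum.Sigma case_prod_beta)
  ultimately show ?thesis by linarith
qed

lemma relevant_le_unspanned_mean:
  assumes "0 \<le> p" "p \<le> 1"
  shows "sample_mean p E (\<lambda>Y. sum w (relevant Y))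
    \<le> sample_mean p E (\<lambda>Y. sum w (unspanned Y)) + sample_mean p E (\<lambda>Y. spanned_outside Y)"
  unfolding sample_mean_add[symmetric]
  using relevant_le_unspanned assms by (intro sample_mean_mono) auto

text \<open>With \<open>?W\<close>, \<open>?G\<close>, \<open>?B\<close> the mean weights of
  relevant, unspanned and spanned relevant elements, \<open>?W \<le> ?G + ?B\<close>, while exchange
  and growth give \<open>p * ?B \<le> (1 - p) * k * ?W\<close>. Eliminating \<open>?B\<close> leaves
  a multiple of \<open>?W\<close>, which \<open>relevant_weight\<close> bounds from below.\<close>

lemma unspanned_weight:
  assumes p: "0 < p" "p \<le> 1" "real k * (1 - p) \<le> p" and "A \<in> I"
  shows "(p - real k * (1 - p)) * (1 - p) * sum w A
    \<le> p * real k * sample_mean p E (\<lambda>Y. sum w (unspanned Y))"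
proof -
  let ?W = "sample_mean p E (\<lambda>Y. sum w (relevant Y))"
  let ?G = "sample_mean p E (\<lambda>Y. sum w (unspanned Y))"
  let ?B = "sample_mean p E (\<lambda>Y. spanned_outside Y)"
  have inside: "sample_mean p E (\<lambda>Y. spanned_inside Y) \<le> sample_mean p E (\<lambda>Y. real k * sum w (relevant Y))"
  proof (rule sample_mean_mono)
    fix Y assume "Y \<subseteq> E"
    have "spanned_inside Y \<le> (\<Sum>j\<in>{1..M}. real (kj j) * sum w ((chosen Y - Y) \<inter> Sj j))"
      by (intro sum_mono component_spanned_le[OF \<open>Y \<subseteq> E\<close>])
    also have "\<dots> \<le> real k * sum w (relevant Y)"
      unfolding relevant_eq using chosen_subset[of Y] w_nonneg by (intro sum_components_le) auto
    finally show "spanned_inside Y \<le> real k * sum w (relevant Y)" .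
  qed (use p in auto)
  then have "p * ?B \<le> (1 - p) * (real k * ?W)"
    unfolding spanned_exchange using p by (intro mult_left_mono) (auto simp: sample_mean_mult)
  moreover have "p * ?W \<le> p * (?G + ?B)"
    using relevant_le_unspanned_mean[of p] p by (intro mult_left_mono) auto
  ultimately have "(p - real k * (1 - p)) * ?W \<le> p * ?G"
    by (simp add: algebra_simps)
  then have "real k * ((p - real k * (1 - p)) * ?W) \<le> real k * (p * ?G)"
    by (intro mult_left_mono) auto
  moreover have "(p - real k * (1 - p)) * ((1 - p) * sum w A) \<le> (p - real k * (1 - p)) * (real k * ?W)"
    using relevant_weight[OF p(1,2) \<open>A \<in> I\<close>] p(3) by (intro mult_left_mono) auto
  ultimately show ?thesis
    by (simp add: mult_ac)
qed

lemma unspanned_weight_matroid: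
  assumes mat: "\<And>j. j \<in> {1..M} \<Longrightarrow> matroid (Sj j) (Ij j)"
    and p: "0 < p" "p \<le> 1" "real k * (1 - p) \<le> 1" and "A \<in> I"
  shows "(1 - real k * (1 - p)) * (1 - p) * sum w A
    \<le> real k * sample_mean p E (\<lambda>Y. sum w (unspanned Y))"
proof -
  let ?W = "sample_mean p E (\<lambda>Y. sum w (relevant Y))"
  let ?G = "sample_mean p E (\<lambda>Y. sum w (unspanned Y))"
  let ?B = "sample_mean p E (\<lambda>Y. spanned_outside Y)"
  have "sample_mean p E (\<lambda>Y. spanned_inside Y + spanned_outside Y)
      \<le> sample_mean p E (\<lambda>Y. real k * sum w (relevant Y))"
  proof (rule sample_mean_mono)
    fix Y assume "Y \<subseteq> E"
    have w0: "0 \<le> sum w ((chosen Y - Y) \<inter> Sj j)" for j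
      using chosen_subset[of Y] w_nonneg by (intro sum_nonneg) auto
    have "spanned_inside Y + spanned_outside Y \<le> (\<Sum>j\<in>{1..M}. sum w ((chosen Y - Y) \<inter> Sj j))"
      unfolding sum.distrib[symmetric]
      by (intro sum_mono component_spanned_le_matroid[OF \<open>Y \<subseteq> E\<close>] mat)
    also have "\<dots> \<le> (\<Sum>j\<in>{1..M}. real (kj j) * sum w ((chosen Y - Y) \<inter> Sj j))"
    proof (rule sum_mono)
      fix j assume "j \<in> {1..M}"
      then have "1 \<le> real (kj j)"
        using growth[of j] by (simp add: growth_system_def)
      then show "sum w ((chosen Y - Y) \<inter> Sj j) \<le> real (kj j) * sum w ((chosen Y - Y) \<inter> Sj j)"
        using mult_right_mono[of 1 "real (kj j)", OF _ w0[of j]] by simp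
    qed
    also have "\<dots> \<le> real k * sum w (relevant Y)"
      unfolding relevant_eq using chosen_subset[of Y] w_nonneg by (intro sum_components_le) auto
    finally show "spanned_inside Y + spanned_outside Y \<le> real k * sum w (relevant Y)" .
  qed (use p in auto)
  \<comment> \<open>By the exchange the left side is \<open>p * ?B\<close>. Moving
    \<open>(1 - p) * ?B\<close> over yields \<open>?B\<close> itself, which improves the bound of
    the growth case by a factor \<open>p\<close>.\<close>
  then have "(1 - p) * sample_mean p E (\<lambda>Y. spanned_inside Y) \<le> (1 - p) * (real k * ?W - ?B)"
    using p by (intro mult_left_mono) (auto simp: sample_mean_mult sample_mean_add)
  then have "?B \<le> (1 - p) * (real k * ?W)"
    unfolding spanned_exchange[symmetric] by (simp add: algebra_simps)
  then have "(1 - real k * (1 - p)) * ?W \<le> ?G"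
    using relevant_le_unspanned_mean[of p] p by (simp add: algebra_simps)
  then have "real k * ((1 - real k * (1 - p)) * ?W) \<le> real k * ?G"
    by (intro mult_left_mono) auto
  moreover have "(1 - real k * (1 - p)) * ((1 - p) * sum w A) \<le> (1 - real k * (1 - p)) * (real k * ?W)"
    using relevant_weight[OF p(1,2) \<open>A \<in> I\<close>] p(3) by (intro mult_left_mono) auto
  ultimately show ?thesis
    by (simp add: mult_ac)
qed

text \<open>Exchanging \<open>f\<close> for a heavier element \<open>x\<close> would improve an optimum whose element \<open>f\<close> is
  spanned by heavier elements; \<open>x\<close> lies in no component other than that of \<open>f\<close>.\<close>

lemma optimum_not_spanned:
  assumes mat: "\<And>j. j \<in> {1..M} \<Longrightarrow> matroid (Sj j) (Ij j)" and "k = 1"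
    and opt: "OPT \<in> I" "\<And>A. A \<in> I \<Longrightarrow> sum w A \<le> sum w OPT"
    and "f \<in> OPT" and j: "j \<in> {1..M}" and X: "\<And>x. x \<in> X \<Longrightarrow> w f < w x"
  shows "\<not> spanned j f X"
proof
  assume span: "spanned j f X"
  define B where "B = OPT \<inter> Sj j - {f}"
  define U where "U = X \<inter> Sj j \<union> B"
  note csys = component[OF j]
  have f: "f \<in> Sj j" "f \<notin> U" "insert f B = OPT \<inter> Sj j"
    using spanned_ground[OF span] X \<open>f \<in> OPT\<close> by (auto simp: U_def B_def)
  have OS: "OPT \<inter> Sj j \<in> Ij j"
    by (rule component_indep[OF opt(1) j])
  have "B \<in> Ij j"
    by (rule indep_system_subset[OF csys OS]) (auto simp: B_def)
  have U: "U \<subseteq> Sj j" "f \<in> phull (Sj j) (Ij j) U"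
    using span phull_mono[of "X \<inter> Sj j" U "Sj j" "Ij j"] by (auto simp: U_def B_def spanned_def)
  obtain P where P: "basis_of (Ij j) U P" "insert f P \<notin> Ij j"
    using phull_obtain_basis[OF csys U f(2)] .
  show False
  \<comment> \<open>If \<open>B\<close> is a basis of \<open>U\<close>, it must block
    \<open>f\<close>, contradicting the independence of the optimum. If not, \<open>B\<close> can be
    extended by some heavier \<open>x\<close> from \<open>X\<close>.\<close>
  proof (cases "basis_of (Ij j) U B")
    case True
    have "insert f B \<notin> Ij j"
      by (rule matroid_basis_insert_dependent[OF mat[OF j] U(1) P(1) True f(2) P(2)])
    then show False
      using OS f(3) by simp
  next
    case False
    then obtain P' where P': "B \<subseteq> P'" "P' \<subseteq> U" "P' \<in> Ij j" "P' \<noteq> B"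
      using \<open>B \<in> Ij j\<close> unfolding basis_of_def U_def by blast
    then obtain x where x: "x \<in> P'" "x \<notin> B"
      by blast
    then have xX: "x \<in> X" "x \<in> Sj j"
      using P' by (auto simp: U_def)
    then have "w f < w x" "x \<notin> OPT" "x \<noteq> f"
      using X x(2) by (auto simp: B_def)
    have "insert x B \<in> Ij j"
      by (rule indep_system_subset[OF csys P'(3)]) (use x P' in blast)
    have "insert x (OPT - {f}) \<in> I"
    proof -
      have "insert x (OPT - {f}) \<inter> Sj i \<in> Ij i" if i: "i \<in> {1..M}" for i
      proof (cases "i = j")
        case True
        have "insert x (OPT - {f}) \<inter> Sj j = insert x B"
          using xX by (auto simp: B_def)
        then show ?thesis
          using True \<open>insert x B \<in> Ij j\<close> by simp
      next
        case False
        have "x \<notin> Sj i"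
        proof
          assume "x \<in> Sj i"
          \<comment> \<open>Growth constants are positive, so two components containing
            \<open>x\<close> would contribute at least 2, whereas \<open>k = 1\<close>.\<close>
          then have "sum kj {i, j} \<le> (\<Sum>j | j \<in> {1..M} \<and> x \<in> Sj j. kj j)"
            using i j xX by (intro sum_mono2) auto
          also have "\<dots> \<le> 1"
            using k_bound[of x] xX component_subset[OF j] \<open>k = 1\<close> by auto
          finally show False
            using growth[OF i] growth[OF j] False by (simp add: growth_system_def)
        qed
        show ?thesis
          by (rule indep_system_subset[OF component[OF i] component_indep[OF opt(1) i]])
            (use \<open>x \<notin> Sj i\<close> in blast)
      qed
      moreover have "insert x (OPT - {f}) \<subseteq> E"
        using xX component_subset[OF j] indep_system_ground[OF sys opt(1)] by auto
      ultimately show ?thesis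
        by (simp add: comb_indep_def)
    qed
    from opt(2)[OF this] have "sum w (insert x (OPT - {f})) \<le> sum w OPT" .
    moreover have "finite OPT"
      using finite_subset[OF indep_system_ground[OF sys opt(1)] finite_E] .
    ultimately show False
      using \<open>x \<notin> OPT\<close> \<open>f \<in> OPT\<close> \<open>w f < w x\<close> by (simp add: sum_diff1)
  qed
qed

lemma optimum_unspanned:
  assumes mat: "\<And>j. j \<in> {1..M} \<Longrightarrow> matroid (Sj j) (Ij j)" and "k = 1"
    and opt: "OPT \<in> I" "\<And>A. A \<in> I \<Longrightarrow> sum w A \<le> sum w OPT"
  shows "OPT \<subseteq> unspanned {}"
proof
  fix f assume "f \<in> OPT"
  then have "f \<in> E"
    using indep_system_ground[OF sys opt(1)] by blast
  have "insert f {g \<in> chosen {} \<inter> {}. w f < w g} \<in> I"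
    by (rule indep_system_subset[OF sys opt(1)]) (use \<open>f \<in> OPT\<close> in auto)
  then have "f \<in> chosen {}"
    using chosen_iff[of "{}" f] \<open>f \<in> E\<close> by simp
  moreover have "\<not> spanned j f (rel_above {} f)" if "j \<in> {1..M}" for j
  proof (rule optimum_not_spanned[OF assms \<open>f \<in> OPT\<close> that])
    show "w f < w x" if "x \<in> rel_above {} f" for x
      using that unfolding rel_above_def by blast
  qed
  then have "f \<notin> Hull (rel_above {} f)"
    by (simp add: hull_iff_spanned)
  ultimately show "f \<in> unspanned {}"
    using \<open>f \<in> E\<close> by blast
qed

text \<open>\<open>C\<close> stands for \<open>S_2\<close>, so \<open>E - Y - C\<close> is
  \<open>S_1\<close>. The condition over all thresholds expresses that, by decreasing weight, the
  relevant part of \<open>S_1\<close> starts to span \<open>f\<close> no later than that of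
  \<open>S_2\<close> without \<open>f\<close>.\<close>

definition secure :: "'a set \<Rightarrow> 'a \<Rightarrow> 'a set \<Rightarrow> bool" where
  "secure Y f C \<longleftrightarrow> f \<in> C \<and>
    (\<forall>\<theta>. f \<in> Hull {x \<in> rel E I w Y \<inter> C - {f}. \<theta> < w x} \<longrightarrow>
      f \<in> Hull {x \<in> rel E I w Y \<inter> (E - Y - C). \<theta> < w x})"

text \<open>Complementing \<open>C\<close> within \<open>E - Y - {f}\<close> exchanges the two sides of the domination condition,
  and one of two sets always dominates the other.\<close>

lemma card_secure_ge:
  assumes "Y \<subseteq> E" "f \<in> E - Y"
  shows "2 ^ card (E - Y) \<le> 4 * card {C. C \<subseteq> E - Y \<and> secure Y f C}"
proof -
  define V where "V = E - Y - {f}"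
  define R where "R = rel E I w Y"
  define dom where "dom C D \<longleftrightarrow> (\<forall>\<theta>. f \<in> Hull {x \<in> R \<inter> D. \<theta> < w x} \<longrightarrow> f \<in> Hull {x \<in> R \<inter> C. \<theta> < w x})" for C D
  define \<D> where "\<D> = {C \<in> Pow V. dom (V - C) C}"
  have "finite V"
    using finite_E by (simp add: V_def)
  \<comment> \<open>Once a set spans \<open>f\<close> above one threshold it does so above all lower
    ones. So the thresholds at which each set spans \<open>f\<close> are closed downwards, and two
    such sets of reals are comparable.\<close>
  have total: "dom C D \<or> dom D C" for C D
  proof (rule ccontr)
    assume "\<not> (dom C D \<or> dom D C)"
    then obtain \<theta> \<theta>' where
      *: "f \<in> Hull {x \<in> R \<inter> D. \<theta> < w x}" "f \<notin> Hull {x \<in> R \<inter> C. \<theta> < w x}"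
        "f \<in> Hull {x \<in> R \<inter> C. \<theta>' < w x}" "f \<notin> Hull {x \<in> R \<inter> D. \<theta>' < w x}"
      unfolding dom_def by blast
    show False
    proof (cases "\<theta> \<le> \<theta>'")
      case True
      then have "Hull {x \<in> R \<inter> C. \<theta>' < w x} \<subseteq> Hull {x \<in> R \<inter> C. \<theta> < w x}"
        by (intro hull_mono) auto
      then show False using * by blast
    next
      case False
      then have "Hull {x \<in> R \<inter> D. \<theta> < w x} \<subseteq> Hull {x \<in> R \<inter> D. \<theta>' < w x}"
        by (intro hull_mono) auto
      then show False using * by blast
    qed
  qed
  have "Pow V \<subseteq> \<D> \<union> (\<lambda>C. V - C) ` \<D>"
  proof
    fix C assume C: "C \<in> Pow V"
    show "C \<in> \<D> \<union> (\<lambda>C. V - C) ` \<D>"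
    proof (cases "C \<in> \<D>")
      case False
      then have "dom C (V - C)"
        using total C by (auto simp: \<D>_def)
      then have "V - C \<in> \<D>" "C = V - (V - C)"
        using C by (auto simp: \<D>_def double_diff)
      then show ?thesis
        by blast
    qed simp
  qed
  moreover have fin: "finite \<D>"
    using \<open>finite V\<close> by (simp add: \<D>_def)
  ultimately have "card (Pow V) \<le> card (\<D> \<union> (\<lambda>C. V - C) ` \<D>)"
    by (intro card_mono) auto
  also have "\<dots> \<le> card \<D> + card \<D>"
    using card_Un_le[of \<D>] card_image_le[OF fin] by (meson add_left_mono le_trans)
  finally have "2 ^ card V \<le> 2 * card \<D>"
    using \<open>finite V\<close> by (simp add: card_Pow)
  moreover have "card (E - Y) = Suc (card V)"
    using assms finite_E unfolding V_def by (intro card_Suc_Diff1[symmetric]) auto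
  \<comment> \<open>The factor 4 is made of a 2 for domination among the subsets of \<open>V\<close>
    and a 2 for requiring that \<open>f\<close> itself be in \<open>C\<close>.\<close>
  moreover have "card \<D> \<le> card {C. C \<subseteq> E - Y \<and> secure Y f C}"
  proof (rule card_inj_on_le[of "insert f"])
    show "inj_on (insert f) \<D>"
      by (auto simp: inj_on_def \<D>_def V_def insert_ident)
    show "insert f ` \<D> \<subseteq> {C. C \<subseteq> E - Y \<and> secure Y f C}"
    proof
      fix C assume "C \<in> insert f ` \<D>"
      then obtain D where D: "D \<subseteq> V" "dom (V - D) D" "C = insert f D"
        by (auto simp: \<D>_def)
      then have eqs: "R \<inter> C - {f} = R \<inter> D" "R \<inter> (E - Y - C) = R \<inter> (V - D)"
        by (auto simp: V_def)
      have "secure Y f C"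
        unfolding secure_def R_def[symmetric] eqs using D(2,3) unfolding dom_def by blast
      then show "C \<in> {C. C \<subseteq> E - Y \<and> secure Y f C}"
        using D assms(2) by (auto simp: V_def)
    qed
    show "finite {C. C \<subseteq> E - Y \<and> secure Y f C}"
      using finite_E by simp
  qed
  ultimately show ?thesis
    by simp
qed

lemma secure_accepted:
  assumes "Y \<subseteq> E" "f \<in> unspanned Y" "secure Y f C"
    and X: "X \<in> outcomes Hull E I w Y (E - Y - C) C"
  shows "f \<in> X"
proof (rule outcomes_secure[OF hull_mono _ indep_system_empty[OF sys] finite_E w_inj w_nonneg _ _ _ _ _ X])
  show "\<And>B. B \<in> I \<Longrightarrow> insert f B \<notin> I \<Longrightarrow> f \<in> Hull B"
    using assms(2) by (intro hull_spans) auto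
  show "f \<notin> Hull {x \<in> rel E I w Y. w f < w x}"
    using assms(2) by (simp add: rel_above_def rel_eq_chosen)
qed (use assms in \<open>auto simp: secure_def rel_eq_chosen\<close>)

end

section \<open>The probability space of the observation times\<close>

text \<open>The interval of the observation times that put \<open>e\<close> into \<open>Y\<close>, into \<open>S\<^sub>2 = C\<close>, or else into \<open>S\<^sub>1\<close>.\<close>

definition phase_cell :: "real \<Rightarrow> 'a set \<Rightarrow> 'a set \<Rightarrow> 'a \<Rightarrow> real set" where
  "phase_cell p Y C e =
     (if e \<in> Y then {0<..<p} else if e \<in> C then {(1 + p) / 2..<1} else {p..<(1 + p) / 2})"

definition phase_event ::
    "real \<Rightarrow> 'a set \<Rightarrow> 'b measure \<Rightarrow> ('a \<Rightarrow> 'b \<Rightarrow> real) \<Rightarrow> 'a set \<Rightarrow> 'a set \<Rightarrow> 'b set" where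
  "phase_event p E \<Omega> t Y C = {\<omega> \<in> space \<Omega>. \<forall>e\<in>E. t e \<omega> \<in> phase_cell p Y C e}"

lemma measure_uniform_unit_interval:
  assumes "0 \<le> a" "a \<le> b" "b \<le> 1"
  shows "measure (uniform_measure lborel {0<..<1}) {a<..<b} = b - a"
    and "measure (uniform_measure lborel {0<..<1}) {a..<b} = b - a"
proof -
  have "measure lborel ({0<..<1} \<inter> {a<..<b}) = b - a"
  proof -
    have "{0<..<1} \<inter> {a<..<b} = {a<..<b}"
      using assms by auto
    then show ?thesis
      using assms by simp
  qed
  then show "measure (uniform_measure lborel {0<..<1}) {a<..<b} = b - a"
    by simp
  \<comment> \<open>The left end point is lost in the intersection exactly when it is 0, which
    happens for the cell of \<open>S_1\<close> when \<open>p = 0\<close>.\<close>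
  have "measure lborel ({0<..<1} \<inter> {a..<b}) = b - a"
  proof (cases "a = 0")
    case True
    then have "{0<..<1} \<inter> {a..<b} = {a<..<b}"
      using assms by auto
    then show ?thesis
      using assms by simp
  next
    case False
    then have "{0<..<1} \<inter> {a..<b} = {a..<b}"
      using assms by auto
    then show ?thesis
      using assms by simp
  qed
  then show "measure (uniform_measure lborel {0<..<1}) {a..<b} = b - a"
    by simp
qed

lemma prob_phase_event:
  assumes "prob_space \<Omega>" and ind: "prob_space.indep_vars \<Omega> (\<lambda>_. borel) t E"
    and uni: "\<And>e. e \<in> E \<Longrightarrow> distr \<Omega> borel (t e) = uniform_measure lborel {0<..<1}"
    and E: "finite E" "E \<noteq> {}" and p: "0 \<le> p" "p < 1" and "Y \<subseteq> E"
  shows "phase_event p E \<Omega> t Y C \<in> sets \<Omega>"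
    and "measure \<Omega> (phase_event p E \<Omega> t Y C) = p ^ card Y * ((1 - p) / 2) ^ card (E - Y)"
proof -
  interpret prob_space \<Omega> by fact
  have rv: "random_variable borel (t e)" if "e \<in> E" for e
    using ind that unfolding indep_vars_def by blast
  have cell: "phase_cell p Y C e \<in> sets borel" for e
    by (simp add: phase_cell_def)
  have ev: "phase_event p E \<Omega> t Y C = (\<Inter>e\<in>E. t e -` phase_cell p Y C e \<inter> space \<Omega>)"
    using E by (auto simp: phase_event_def)
  show "phase_event p E \<Omega> t Y C \<in> sets \<Omega>"
    unfolding ev using E rv cell by (intro sets.finite_INT measurable_sets[where A = borel]) auto
  have one: "prob (t e -` phase_cell p Y C e \<inter> space \<Omega>) = (if e \<in> Y then p else (1 - p) / 2)" if "e \<in> E" for e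
  proof -
    have "prob (t e -` phase_cell p Y C e \<inter> space \<Omega>) = measure (distr \<Omega> borel (t e)) (phase_cell p Y C e)"
      using rv[OF that] cell by (simp add: measure_distr)
    also have "\<dots> = (if e \<in> Y then p else (1 - p) / 2)"
      unfolding uni[OF that] phase_cell_def
      using p measure_uniform_unit_interval(1)[of 0 p]
        measure_uniform_unit_interval(2)[of p "(1 + p) / 2"]
        measure_uniform_unit_interval(2)[of "(1 + p) / 2" 1]
      by (auto simp: field_simps simp del: measure_uniform_measure)
    finally show ?thesis .
  qed
  have "prob (phase_event p E \<Omega> t Y C) = (\<Prod>e\<in>E. if e \<in> Y then p else (1 - p) / 2)"
    unfolding ev using indep_varsD[OF ind E(2,1) subset_refl, of "phase_cell p Y C"] cell one by simp
  also have "\<dots> = p ^ card Y * ((1 - p) / 2) ^ card (E - Y)"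
    using E(1) \<open>Y \<subseteq> E\<close> by (simp add: prod.If_cases Int_absorb1 Diff_eq)
  finally show "prob (phase_event p E \<Omega> t Y C) = p ^ card Y * ((1 - p) / 2) ^ card (E - Y)" .
qed

lemma phase_event_sets:
  assumes p: "0 \<le> p" "p < 1" and "Y \<subseteq> E" "C \<subseteq> E - Y" and \<omega>: "\<omega> \<in> phase_event p E \<Omega> t Y C"
  shows "{e \<in> E. t e \<omega> \<in> {0<..<p}} = Y"
    and "{e \<in> E. t e \<omega> \<in> {p..<(1 + p) / 2}} = E - Y - C"
    and "{e \<in> E. t e \<omega> \<in> {(1 + p) / 2..<1}} = C"
proof -
  have cell: "t e \<omega> \<in> phase_cell p Y C e" if "e \<in> E" for e
    using \<omega> that by (simp add: phase_event_def)
  have half: "p \<le> (1 + p) / 2"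
    using p by simp
  have "(t e \<omega> \<in> {0<..<p} \<longleftrightarrow> e \<in> Y) \<and> (t e \<omega> \<in> {p..<(1 + p) / 2} \<longleftrightarrow> e \<notin> Y \<and> e \<notin> C)
      \<and> (t e \<omega> \<in> {(1 + p) / 2..<1} \<longleftrightarrow> e \<in> C)" if "e \<in> E" for e
    using cell[OF that] half assms(4) by (auto simp: phase_cell_def split: if_splits)
  then show "{e \<in> E. t e \<omega> \<in> {0<..<p}} = Y" "{e \<in> E. t e \<omega> \<in> {p..<(1 + p) / 2}} = E - Y - C"
    "{e \<in> E. t e \<omega> \<in> {(1 + p) / 2..<1}} = C"
    using assms(3,4) by blast+
qed

lemma sets_member_random_set:
  assumes "X \<in> measurable \<Omega> (count_space (Pow E))"
  shows "{\<omega> \<in> space \<Omega>. f \<in> X \<omega>} \<in> sets \<Omega>"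
proof -
  have "{\<omega> \<in> space \<Omega>. f \<in> X \<omega>} = X -` {A \<in> Pow E. f \<in> A} \<inter> space \<Omega>"
    using measurable_space[OF assms] by auto
  then show ?thesis
    using measurable_sets[OF assms, of "{A \<in> Pow E. f \<in> A}"] by auto
qed

section \<open>From acceptance probabilities to the expected weight\<close>

context growth_combination
begin

text \<open>The phase events of the pairs \<open>(Y, C)\<close> with \<open>f\<close> unspanned and
  secure are disjoint, and on each of them every order of observation accepts \<open>f\<close>. For
  fixed \<open>Y\<close> there are at least a quarter of all possible \<open>C\<close>, and their
  number cancels the halves in the probability of one event.\<close>

lemma prob_accept:
  assumes exec: "free_order_execution M Sj Ij w p \<Omega> t ALG" and "E \<noteq> {}"
    and p: "0 \<le> p" "p < 1" and "f \<in> E"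
  shows "sample_mean p E (\<lambda>Y. of_bool (f \<in> unspanned Y)) / 4 \<le> measure \<Omega> {\<omega> \<in> space \<Omega>. f \<in> ALG \<omega>}"
proof -
  interpret prob_space \<Omega>
    using exec by (simp add: free_order_execution_def)
  define V where "V = phase_event p E \<Omega> t"
  define P where "P = Sigma {Y \<in> Pow E. f \<in> unspanned Y} (\<lambda>Y. {C. C \<subseteq> E - Y \<and> secure Y f C})"
  have P: "Y \<subseteq> E" "f \<in> unspanned Y" "C \<subseteq> E - Y" "secure Y f C" if "(Y, C) \<in> P" for Y C
    using that by (auto simp: P_def)
  have V: "V Y C \<in> sets \<Omega>" "prob (V Y C) = p ^ card Y * ((1 - p) / 2) ^ card (E - Y)" if "Y \<subseteq> E" for Y C
    unfolding V_def
    using prob_phase_event[OF prob_space_axioms, of t E p Y C] exec \<open>E \<noteq> {}\<close> finite_E p that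
    by (auto simp: free_order_execution_def)
  have "finite P"
    using finite_E by (auto simp: P_def)
  have disj: "disjoint_family_on (\<lambda>(Y, C). V Y C) P"
    unfolding disjoint_family_on_def
  proof (intro ballI impI)
    fix x y assume xy: "x \<in> P" "y \<in> P" "x \<noteq> y"
    obtain Y C Y' C' where eq: "x = (Y, C)" "y = (Y', C')"
      by fastforce
    have 1: "(Y, C) \<in> P" "(Y', C') \<in> P"
      using xy eq by auto
    have "Y = Y' \<and> C = C'" if "\<omega> \<in> V Y C" "\<omega> \<in> V Y' C'" for \<omega>
      using phase_event_sets(1,3)[OF p P(1,3)[OF 1(1)], of \<omega> \<Omega> t]
        phase_event_sets(1,3)[OF p P(1,3)[OF 1(2)], of \<omega> \<Omega> t] that unfolding V_def by simp
    then show "(case x of (Y, C) \<Rightarrow> V Y C) \<inter> (case y of (Y, C) \<Rightarrow> V Y C) = {}"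
      using xy(3) eq by auto
  qed
  have ALG: "ALG \<in> measurable \<Omega> (count_space (Pow E))"
    using exec by (simp add: free_order_execution_def)
  have sets: "{\<omega> \<in> space \<Omega>. f \<in> ALG \<omega>} \<in> sets \<Omega>"
    by (rule sets_member_random_set[OF ALG])
  have accepted: "f \<in> ALG \<omega>" if YC: "(Y, C) \<in> P" and \<omega>: "\<omega> \<in> V Y C" for Y C \<omega>
  proof -
    have "ALG \<omega> \<in> run_outcomes M Sj Ij w p (\<lambda>e. t e \<omega>)"
      using exec \<omega> by (simp add: free_order_execution_def V_def phase_event_def)
    then have "ALG \<omega> \<in> outcomes Hull E I w Y (E - Y - C) C"
      using phase_event_sets[OF p P(1,3)[OF YC], of \<omega> \<Omega> t] \<omega> unfolding run_outcomes_def V_def by simp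
    then show ?thesis
      using secure_accepted P[OF YC] by blast
  qed
  have "sample_mean p E (\<lambda>Y. of_bool (f \<in> unspanned Y)) / 4
      = (\<Sum>Y\<in>{Y \<in> Pow E. f \<in> unspanned Y}. p ^ card Y * (1 - p) ^ card (E - Y) / 4)"
    using finite_E by (simp add: sample_mean_def sum_divide_distrib of_bool_def if_distrib
        flip: sum.inter_filter cong: if_cong)
  also have "\<dots> \<le> (\<Sum>Y\<in>{Y \<in> Pow E. f \<in> unspanned Y}.
      real (card {C. C \<subseteq> E - Y \<and> secure Y f C}) * (p ^ card Y * ((1 - p) / 2) ^ card (E - Y)))"
  proof (rule sum_mono)
    fix Y assume Y: "Y \<in> {Y \<in> Pow E. f \<in> unspanned Y}"
    let ?n = "card {C. C \<subseteq> E - Y \<and> secure Y f C}" and ?q = "p ^ card Y * ((1 - p) / 2) ^ card (E - Y)"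
    have "2 ^ card (E - Y) \<le> 4 * ?n"
      using card_secure_ge[of Y f] Y by simp
    then have "real (2 ^ card (E - Y)) \<le> real (4 * ?n)"
      by (rule of_nat_mono)
    then have "(2::real) ^ card (E - Y) / 4 \<le> real ?n"
      by simp
    then have "2 ^ card (E - Y) / 4 * ?q \<le> real ?n * ?q"
      using p by (intro mult_right_mono) auto
    then show "p ^ card Y * (1 - p) ^ card (E - Y) / 4 \<le> real ?n * ?q"
      by (simp add: power_divide)
  qed
  also have "\<dots> = (\<Sum>(Y, C)\<in>P. prob (V Y C))"
    unfolding P_def using finite_E V(2) by (subst sum.Sigma[symmetric]) auto
  also have "\<dots> = prob (\<Union>(Y, C)\<in>P. V Y C)"
  proof -
    have "(\<lambda>(Y, C). V Y C) ` P \<subseteq> events"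
      using V(1) P(1) by auto
    from finite_measure_finite_Union[OF \<open>finite P\<close> this disj] show ?thesis
      by (simp add: case_prod_beta)
  qed
  also have "\<dots> \<le> prob {\<omega> \<in> space \<Omega>. f \<in> ALG \<omega>}"
    using accepted by (intro finite_measure_mono sets) (auto simp: V_def phase_event_def)
  finally show ?thesis .
qed

text \<open>Linearity of expectation over the elements of \<open>E\<close> reduces the competitive
  ratio to a lower bound on the mean unspanned weight; the factor 4 comes from
  \<open>prob_accept\<close>.\<close>

lemma competitive:
  assumes exec: "free_order_execution M Sj Ij w p \<Omega> t ALG" and "E \<noteq> {}" and p: "0 \<le> p" "p < 1"
    and opt: "\<And>OPT. OPT \<in> I \<Longrightarrow> (\<And>A. A \<in> I \<Longrightarrow> sum w A \<le> sum w OPT) \<Longrightarrow>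
      4 * \<alpha> * sum w OPT \<le> sample_mean p E (\<lambda>Y. sum w (unspanned Y))"
  shows "utility_competitive I w \<Omega> ALG \<alpha>"
proof -
  interpret prob_space \<Omega>
    using exec by (simp add: free_order_execution_def)
  have ALG: "ALG \<in> measurable \<Omega> (count_space (Pow E))"
    using exec by (simp add: free_order_execution_def)
  have ALG_I: "ALG \<omega> \<in> I" if "\<omega> \<in> space \<Omega>" for \<omega>
    using exec that outcomes_indep[OF indep_system_empty[OF sys]]
    unfolding free_order_execution_def run_outcomes_def by blast
  have sets: "{\<omega> \<in> space \<Omega>. f \<in> ALG \<omega>} \<in> sets \<Omega>" for f
    by (rule sets_member_random_set[OF ALG])
  have "expectation (\<lambda>\<omega>. sum w (ALG \<omega>))
      = expectation (\<lambda>\<omega>. \<Sum>f\<in>E. w f * indicator {\<omega> \<in> space \<Omega>. f \<in> ALG \<omega>} \<omega>)"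
  proof (rule Bochner_Integration.integral_cong[OF refl])
    fix \<omega> assume \<omega>: "\<omega> \<in> space \<Omega>"
    have "sum w (ALG \<omega>) = (\<Sum>f\<in>E. if f \<in> ALG \<omega> then w f else 0)"
      using finite_E indep_system_ground[OF sys ALG_I[OF \<omega>]]
      by (simp add: Int_absorb1 flip: sum.inter_restrict)
    then show "sum w (ALG \<omega>) = (\<Sum>f\<in>E. w f * indicator {\<omega> \<in> space \<Omega>. f \<in> ALG \<omega>} \<omega>)"
      using \<omega> by (auto simp: indicator_def intro!: sum.cong)
  qed
  also have "\<dots> = (\<Sum>f\<in>E. w f * prob {\<omega> \<in> space \<Omega>. f \<in> ALG \<omega>})"
    using sets by (subst Bochner_Integration.integral_sum) (auto simp: emeasure_eq_measure)
  finally have "expectation (\<lambda>\<omega>. sum w (ALG \<omega>)) = (\<Sum>f\<in>E. w f * prob {\<omega> \<in> space \<Omega>. f \<in> ALG \<omega>})" .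
  moreover have "(\<Sum>f\<in>E. w f * (sample_mean p E (\<lambda>Y. of_bool (f \<in> unspanned Y)) / 4))
      \<le> (\<Sum>f\<in>E. w f * prob {\<omega> \<in> space \<Omega>. f \<in> ALG \<omega>})"
    using prob_accept[OF exec \<open>E \<noteq> {}\<close> p] w_nonneg by (intro sum_mono mult_left_mono) auto
  moreover have "sample_mean p E (\<lambda>Y. sum w (unspanned Y))
      = (\<Sum>f\<in>E. w f * sample_mean p E (\<lambda>Y. of_bool (f \<in> unspanned Y)))"
    by (rule sample_mean_sum_Collect[OF finite_E]) auto
  ultimately have mean: "sample_mean p E (\<lambda>Y. sum w (unspanned Y)) \<le> 4 * expectation (\<lambda>\<omega>. sum w (ALG \<omega>))"
    by (simp add: sum_divide_distrib[symmetric])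
  show ?thesis
    unfolding utility_competitive_def
  proof (intro conjI ballI allI impI)
    fix OPT assume "is_arg_max (sum w) (\<lambda>A. A \<in> I) OPT"
    then have "OPT \<in> I" "\<And>A. A \<in> I \<Longrightarrow> sum w A \<le> sum w OPT"
      unfolding is_arg_max_linorder by auto
    from opt[OF this] mean show "\<alpha> * sum w OPT \<le> expectation (\<lambda>\<omega>. sum w (ALG \<omega>))"
      by simp
  qed (rule ALG_I)
qed

end

section \<open>The competitive ratios\<close>

text \<open>This \<open>p\<close> maximises the ratio obtained from \<open>unspanned_weight\<close>,
  which equals \<open>(2 * k + 1 - (k + 1) * p - k / p) / (4 * k)\<close> and is stationary where
  the square of \<open>p\<close> is \<open>k / (k + 1)\<close>.\<close>

lemma growth_ratio:
  fixes k :: nat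
  assumes "0 < k"
  defines "p \<equiv> sqrt (1 - 1 / (real k + 1))"
  shows "0 < p" "p < 1" "real k * (1 - p) \<le> p"
    and "1 / 2 + 1 / (4 * real k) - 1 / 2 * sqrt (1 + 1 / real k)
      = (p - real k * (1 - p)) * (1 - p) / (4 * (p * real k))"
proof -
  have k: "0 < real k"
    using assms by simp
  have q: "1 - 1 / (real k + 1) = real k / (real k + 1)"
    using k by (simp add: field_simps)
  show p0: "0 < p" and p1: "p < 1"
    using k unfolding p_def by (auto simp: field_simps)
  have p2: "p\<^sup>2 = real k / (real k + 1)"
    unfolding p_def q using k by simp
  have "p * p \<le> p * 1"
    using p0 p1 by (intro mult_left_mono) auto
  then have "real k / (real k + 1) \<le> p"
    using p2 by (simp add: power2_eq_square)
  then show "real k * (1 - p) \<le> p"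
    using k by (simp add: field_simps)
  have "1 + 1 / real k = (1 / p)\<^sup>2"
    unfolding power_divide p2 using k by (simp add: field_simps)
  then have s: "sqrt (1 + 1 / real k) = 1 / p"
    using p0 by simp
  have e: "p\<^sup>2 * (real k + 1) = real k"
    using p2 k by simp
  have "(p - real k * (1 - p)) * (1 - p) = 2 * real k * p + p - real k - p\<^sup>2 * (real k + 1)"
    by (simp add: algebra_simps power2_eq_square)
  also have "\<dots> = 2 * real k * p + p - 2 * real k"
    using e by simp
  finally show "1 / 2 + 1 / (4 * real k) - 1 / 2 * sqrt (1 + 1 / real k)
      = (p - real k * (1 - p)) * (1 - p) / (4 * (p * real k))"
    unfolding s using k p0 by (simp add: field_simps)
qed

text \<open>With \<open>x = 1 / k\<close>, the cubic Taylor polynomial of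
  \<open>sqrt (1 + x)\<close> at 0 lies strictly above it for \<open>0 < x \<le> 1\<close>, since
  its square exceeds \<open>1 + x\<close>. Substituting it gives exactly the claimed bound.\<close>

lemma growth_ratio_bound:
  fixes k :: nat
  assumes "0 < k"
  shows "1 / (16 * real k ^ 2) - 1 / (32 * real k ^ 3)
    < 1 / 2 + 1 / (4 * real k) - 1 / 2 * sqrt (1 + 1 / real k)"
proof -
  define x where "x = 1 / real k"
  have x: "0 < x" "x \<le> 1"
    using assms by (auto simp: x_def)
  have "x ^ 5 \<le> x ^ 4"
    using x power_decreasing[of 4 5 x] by simp
  moreover have "0 < x ^ 4" "0 < x ^ 6"
    using x by auto
  moreover have "(1 + x / 2 - x\<^sup>2 / 8 + x ^ 3 / 16)\<^sup>2 = 1 + x + 5 / 64 * x ^ 4 - x ^ 5 / 64 + x ^ 6 / 256"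
    by (simp add: field_simps power2_eq_square power3_eq_cube power4_eq_xxxx eval_nat_numeral)
  ultimately have "1 + x < (1 + x / 2 - x\<^sup>2 / 8 + x ^ 3 / 16)\<^sup>2"
    by linarith
  moreover have "x\<^sup>2 \<le> 1"
    using x by (simp add: power_le_one)
  then have "0 \<le> 1 + x / 2 - x\<^sup>2 / 8 + x ^ 3 / 16"
    using x zero_le_power[of x 3] by linarith
  ultimately have "sqrt (1 + x) < 1 + x / 2 - x\<^sup>2 / 8 + x ^ 3 / 16"
    by (intro real_less_lsqrt)
  moreover have "1 / (16 * real k ^ 2) = x\<^sup>2 / 16" "1 / (32 * real k ^ 3) = x ^ 3 / 32"
    "1 / (4 * real k) = x / 4" "sqrt (1 + 1 / real k) = sqrt (1 + x)"
    by (simp_all add: x_def power_divide)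
  ultimately show ?thesis
    by linarith
qed

text \<open>With \<open>q = 1 - p\<close> the factor from \<open>unspanned_weight_matroid\<close> is
  \<open>q * (1 - k * q)\<close>, which is largest at \<open>q = 1 / (2 * k)\<close>, with value
  \<open>1 / (4 * k)\<close>.\<close>

lemma matroid_ratio:
  fixes k :: nat
  assumes "0 < k"
  defines "p \<equiv> 1 - 1 / (2 * real k)"
  shows "0 < p" "p < 1" "real k * (1 - p) \<le> 1"
    and "4 * (1 / (16 * real k ^ 2)) * real k = (1 - real k * (1 - p)) * (1 - p)"
  using assms by (auto simp: p_def field_simps power2_eq_square)

theorem theorem5:
  fixes M k :: nat
    and Sj :: "nat \<Rightarrow> 'a set" and Ij :: "nat \<Rightarrow> 'a set set" and kj :: "nat \<Rightarrow> nat"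
    and w :: "'a \<Rightarrow> real"
    and \<Omega> :: "'b measure" and t :: "'a \<Rightarrow> 'b \<Rightarrow> real" and ALG :: "'b \<Rightarrow> 'a set"
  assumes growth: "\<And>j. j \<in> {1..M} \<Longrightarrow> growth_system (kj j) (Sj j) (Ij j)"
    and nonempty: "comb_ground M Sj \<noteq> {}"
    and w_nonneg: "\<And>e. e \<in> comb_ground M Sj \<Longrightarrow> 0 \<le> w e"
    and w_inj: "inj_on w (comb_ground M Sj)"
    and k: "k = Max ((\<lambda>e. \<Sum>j | j \<in> {1..M} \<and> e \<in> Sj j. kj j) ` comb_ground M Sj)"
  shows "(free_order_execution M Sj Ij w (sqrt (1 - 1 / (real k + 1))) \<Omega> t ALG \<longrightarrow>
            utility_competitive (comb_indep M Sj Ij) w \<Omega> ALG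
              (1 / 2 + 1 / (4 * real k) - 1 / 2 * sqrt (1 + 1 / real k))) \<and>
         1 / 2 + 1 / (4 * real k) - 1 / 2 * sqrt (1 + 1 / real k)
            > 1 / (16 * real k ^ 2) - 1 / (32 * real k ^ 3) \<and>
         ((\<forall>j\<in>{1..M}. matroid (Sj j) (Ij j) \<and> kj j = 1) \<longrightarrow>
            (k = 1 \<longrightarrow> free_order_execution M Sj Ij w 0 \<Omega> t ALG \<longrightarrow>
               utility_competitive (comb_indep M Sj Ij) w \<Omega> ALG (1 / 4)) \<and>
            (k \<ge> 2 \<longrightarrow> free_order_execution M Sj Ij w (1 - 1 / (2 * real k)) \<Omega> t ALG \<longrightarrow>
               utility_competitive (comb_indep M Sj Ij) w \<Omega> ALG (1 / (16 * real k ^ 2))))"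
proof -
  let ?m = "\<lambda>e. \<Sum>j | j \<in> {1..M} \<and> e \<in> Sj j. kj j"
  have fin: "finite (comb_ground M Sj)"
    using comb_indep_system[of M Sj Ij] growth_system_indep[OF growth] indep_system_finite by metis
  have bound: "?m e \<le> k" if "e \<in> comb_ground M Sj" for e
    unfolding k using fin that by (intro Max_ge) auto
  obtain e where "e \<in> comb_ground M Sj"
    using nonempty by blast
  moreover then obtain j where "j \<in> {1..M}" "e \<in> Sj j"
    by (auto simp: comb_ground_def)
  ultimately have e: "e \<in> comb_ground M Sj" "j \<in> {1..M}" "e \<in> Sj j"
    by auto
  have "0 < kj j"
    using growth[OF e(2)] by (simp add: growth_system_def)
  also have "kj j \<le> ?m e"
    using e by (intro member_le_sum) auto
  also have "\<dots> \<le> k"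
    by (rule bound[OF e(1)])
  finally have "0 < k" .
  interpret growth_combination M k Sj Ij kj w
    by standard (fact growth w_nonneg w_inj \<open>0 < k\<close> bound)+
  have "utility_competitive I w \<Omega> ALG (1 / 2 + 1 / (4 * real k) - 1 / 2 * sqrt (1 + 1 / real k))"
    if "free_order_execution M Sj Ij w (sqrt (1 - 1 / (real k + 1))) \<Omega> t ALG"
  proof (rule competitive[OF that nonempty])
    define p where "p = sqrt (1 - 1 / (real k + 1))"
    note p = growth_ratio[OF \<open>0 < k\<close>, folded p_def]
    show "0 \<le> sqrt (1 - 1 / (real k + 1))" "sqrt (1 - 1 / (real k + 1)) < 1"
      using p(1,2) unfolding p_def by auto
    fix OPT assume "OPT \<in> I"
    have "0 < p * real k"
      using p(1) \<open>0 < k\<close> by simp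
    have "(p - real k * (1 - p)) * (1 - p) * sum w OPT / (p * real k)
        \<le> sample_mean p E (\<lambda>Y. sum w (unspanned Y))"
      using unspanned_weight[OF p(1) _ p(3) \<open>OPT \<in> I\<close>] p(2)
      unfolding pos_divide_le_eq[OF \<open>0 < p * real k\<close>] by (simp only: mult.commute less_imp_le)
    then show "4 * (1 / 2 + 1 / (4 * real k) - 1 / 2 * sqrt (1 + 1 / real k)) * sum w OPT
        \<le> sample_mean (sqrt (1 - 1 / (real k + 1))) E (\<lambda>Y. sum w (unspanned Y))"
      unfolding p(4) p_def[symmetric] by simp
  qed
  moreover have "utility_competitive I w \<Omega> ALG (1 / 4)"
    if mat: "\<forall>j\<in>{1..M}. matroid (Sj j) (Ij j) \<and> kj j = 1" and "k = 1"
      and exec: "free_order_execution M Sj Ij w 0 \<Omega> t ALG"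
  proof (rule competitive[OF exec nonempty])
    fix OPT assume opt: "OPT \<in> I" "\<And>A. A \<in> I \<Longrightarrow> sum w A \<le> sum w OPT"
    have "OPT \<subseteq> unspanned {}"
      by (rule optimum_unspanned[OF _ \<open>k = 1\<close> opt]) (use mat in auto)
    then have "sum w OPT \<le> sum w (unspanned {})"
      using finite_E w_nonneg by (intro sum_mono2) auto
    also have "\<dots> = sample_mean 0 E (\<lambda>Y. sum w (unspanned Y))"
    proof -
      \<comment> \<open>For \<open>p = 0\<close> the sample is empty: only \<open>Y = {}\<close>
        survives, where the power of 0 with exponent 0 is 1.\<close>
      have "sample_mean 0 E h = h {}" for h
      proof -
        have "sample_mean 0 E h = (\<Sum>Y\<in>Pow E. if Y = {} then h Y else 0)"
          unfolding sample_mean_def using finite_E finite_subset[of _ E]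
          by (intro sum.cong refl) (auto simp: power_0_left)
        then show ?thesis
          using finite_E by simp
      qed
      then show ?thesis by simp
    qed
    finally show "4 * (1 / 4) * sum w OPT \<le> sample_mean 0 E (\<lambda>Y. sum w (unspanned Y))"
      by simp
  qed auto
  moreover have "utility_competitive I w \<Omega> ALG (1 / (16 * real k ^ 2))"
    if mat: "\<forall>j\<in>{1..M}. matroid (Sj j) (Ij j) \<and> kj j = 1"
      and exec: "free_order_execution M Sj Ij w (1 - 1 / (2 * real k)) \<Omega> t ALG"
  proof (rule competitive[OF exec nonempty])
    define p where "p = 1 - 1 / (2 * real k)"
    note p = matroid_ratio[OF \<open>0 < k\<close>, folded p_def]
    show "0 \<le> 1 - 1 / (2 * real k)" "1 - 1 / (2 * real k) < 1"
      using p(1,2) unfolding p_def by auto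
    fix OPT assume "OPT \<in> I"
    have "(1 - real k * (1 - p)) * (1 - p) * sum w OPT
        \<le> real k * sample_mean p E (\<lambda>Y. sum w (unspanned Y))"
      using mat p(1,2,3) \<open>OPT \<in> I\<close> by (intro unspanned_weight_matroid) auto
    then have "real k * (4 * (1 / (16 * real k ^ 2)) * sum w OPT)
        \<le> real k * sample_mean p E (\<lambda>Y. sum w (unspanned Y))"
      unfolding p(4)[symmetric] by (simp add: mult_ac)
    then show "4 * (1 / (16 * real k ^ 2)) * sum w OPT
        \<le> sample_mean (1 - 1 / (2 * real k)) E (\<lambda>Y. sum w (unspanned Y))"
      unfolding p_def[symmetric] using \<open>0 < k\<close>
      by (simp only: mult_le_cancel_left_pos of_nat_0_less_iff)
  qed
  ultimately show ?thesis
    using growth_ratio_bound[OF \<open>0 < k\<close>] by blast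
qed

end
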